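(* Let $(\mathsf{X},\mathcal{A},\pi)$ be a probability space, let $(\mathsf{Y},\mathcal{B})$, $(\mathsf{Z},\mathcal{C})$ be measurable spaces, and let $\tilde\pi$ be a probability measure on $\mathcal{B}\times\mathcal{C}$ with $\tilde\pi(\mathrm{d}(y,z))=\varpi_z(\mathrm{d}y)\,\varpi(\mathrm{d}z)$, where $\varpi$ is the marginal of $\tilde\pi$ on $\mathsf{Z}$. Let $S$ be a Markov transition kernel on $\mathsf{X}$ reversible with respect to $\pi$. Assume: (1) as an operator on $L_0^2(\pi)$, $S=P^*QP$, where $P:L_0^2(\pi)\to L_0^2(\tilde\pi)$ is a linear transformation and $Q$ is (the operator on $L_0^2(\tilde\pi)$ of) a Markov transition kernel on $\mathsf{Y}\times\mathsf{Z}$ reversible with respect to $\tilde\pi$; (2) $\|Pf\|_{\tilde\pi}\le\|f\|_\pi$ for all $f\in L_0^2(\pi)$; (3) $\{Q_z\}_{z\in\mathsf{Z}}$ are Markov transition kernels on $\mathsf{Y}$ such that $Q_z$ is reversible with respect to $\varpi_z$ for $\varpi$-a.e. $z$, and $(y,z)\mapsto Q_z(y,\mathsf{B})$ is measurable for each $\mathsf{B}\in\mathcal{B}$; (4) there is a constant $c_0\in(0,1]$ such that, for $\tilde\pi$-a.e. $(y,z)\in\mathsf{Y}\times\mathsf{Z}$ and every $\mathsf{B}\in\mathcal{B}$, $Q((y,z),(\mathsf{B}\setminus\{y\})\times\{z\})\ge c_0\,Q_z(y,\mathsf{B}\setminus\{y\})$. Suppose that there is a constant $\kappa_\dagger\in[0,1]$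 such that $\mathrm{Gap}(Q_z)\ge\kappa_\dagger$ for $\varpi$-a.e. $z\in\mathsf{Z}$. Then $$\mathrm{Gap}(S)\ \ge\ c_0\,\mathrm{Gap}(P^*\hat QP)\ \ge\ c_0\,\kappa_\dagger\,\mathrm{Gap}(P^*E^*EP).$$
   Context: For a probability measure $\rho$, $L_0^2(\rho)$ is the Hilbert space of real square-integrable functions with $\rho$-mean zero, with inner product $\langle\cdot,\cdot\rangle_\rho$ and norm $\|\cdot\|_\rho$. A Markov transition kernel $K$ with $\rho K=\rho$ acts on $L_0^2(\rho)$ by $Kf(w)=\int K(w,\mathrm{d}w')f(w')$; it is reversible iff this operator is self-adjoint. For self-adjoint $J$ on $L_0^2(\rho)$ with norm at most $1$: $\mathrm{Gap}(J)=\inf_{f\in L_0^2(\rho)\setminus\{0\}}(\|f\|_\rho^2-\langle f,Jf\rangle_\rho)/\|f\|_\rho^2$. The gap of $Q_z$ is computed in $L_0^2(\varpi_z)$; the gaps of $S$, $P^*\hat QP$ and $P^*E^*EP$ in $L_0^2(\pi)$. $P^*$ is the Hilbert-space adjoint of $P$. $\hat Q$ is the Markov transition kernel on $\mathsf{Y}\times\mathsf{Z}$ given by $\hat Q((y,z),\mathrm{d}(y',z'))=Q_z(y,\mathrm{d}y')\,\delta_z(\mathrm{d}z')$, which is reversible with respect to $\tilde\pi$. $E:L_0^2(\tilde\pi)\to L_0^2(\varpi)$ is $Eh(z)=\int_{\mathsf{Y}}h(y,z)\,\varpi_z(\mathrm{d}y)$, with adjoint $E^*g(y,z)=g(z)$.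 Singletons of $\mathsf{Y}$ and $\mathsf{Z}$ are understood to be measurable, so that (4) makes sense. *)

theory Defs
  imports "HOL-Probability.Probability"
begin

text \<open>Elements of \<open>L\<^sub>0\<^sup>2(\<rho>)\<close> are represented by functions; equality in
  \<open>L\<^sub>0\<^sup>2(\<rho>)\<close> is equality \<open>\<rho>\<close>-almost everywhere, and operators are maps between
  functions, compared almost everywhere.\<close>

definition L20 :: "'a measure \<Rightarrow> ('a \<Rightarrow> real) set" where
  "L20 \<rho> = {f \<in> borel_measurable \<rho>. integrable \<rho> (\<lambda>x. (f x)\<^sup>2) \<and> (\<integral>x. f x \<partial>\<rho>) = 0}"

definition L2_inner :: "'a measure \<Rightarrow> ('a \<Rightarrow> real) \<Rightarrow> ('a \<Rightarrow> real) \<Rightarrow> real" where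
  "L2_inner \<rho> f g = (\<integral>x. f x * g x \<partial>\<rho>)"

definition L2_norm :: "'a measure \<Rightarrow> ('a \<Rightarrow> real) \<Rightarrow> real" where
  "L2_norm \<rho> f = sqrt (L2_inner \<rho> f f)"

definition L20_linear ::
    "'a measure \<Rightarrow> 'b measure \<Rightarrow> (('a \<Rightarrow> real) \<Rightarrow> ('b \<Rightarrow> real)) \<Rightarrow> bool" where
  "L20_linear \<rho> \<sigma> T \<longleftrightarrow>
     (\<forall>f\<in>L20 \<rho>. T f \<in> L20 \<sigma>) \<and>
     (\<forall>f\<in>L20 \<rho>. \<forall>g\<in>L20 \<rho>. (AE x in \<rho>. f x = g x) \<longrightarrow> (AE y in \<sigma>. T f y = T g y)) \<and>
     (\<forall>f\<in>L20 \<rho>. \<forall>g\<in>L20 \<rho>. AE y in \<sigma>. T (\<lambda>x. f x + g x) y = T f y + T g y) \<and>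
     (\<forall>f\<in>L20 \<rho>. \<forall>c. AE y in \<sigma>. T (\<lambda>x. c * f x) y = c * T f y)"

definition is_L2_adjoint ::
    "'a measure \<Rightarrow> 'b measure \<Rightarrow> (('a \<Rightarrow> real) \<Rightarrow> ('b \<Rightarrow> real)) \<Rightarrow>
     (('b \<Rightarrow> real) \<Rightarrow> ('a \<Rightarrow> real)) \<Rightarrow> bool" where
  "is_L2_adjoint \<rho> \<sigma> T T' \<longleftrightarrow>
     (\<forall>g\<in>L20 \<sigma>. T' g \<in> L20 \<rho>) \<and>
     (\<forall>f\<in>L20 \<rho>. \<forall>g\<in>L20 \<sigma>. L2_inner \<sigma> (T f) g = L2_inner \<rho> f (T' g))"

text \<open>For a bounded operator the adjoint exists and each of its values is unique up to
  almost everywhere equality, so the choice below only selects representatives.\<close>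

definition L2_adjoint ::
    "'a measure \<Rightarrow> 'b measure \<Rightarrow> (('a \<Rightarrow> real) \<Rightarrow> ('b \<Rightarrow> real)) \<Rightarrow>
     (('b \<Rightarrow> real) \<Rightarrow> ('a \<Rightarrow> real))" where
  "L2_adjoint \<rho> \<sigma> T = (SOME T'. is_L2_adjoint \<rho> \<sigma> T T')"

definition self_adjoint :: "'a measure \<Rightarrow> (('a \<Rightarrow> real) \<Rightarrow> ('a \<Rightarrow> real)) \<Rightarrow> bool" where
  "self_adjoint \<rho> J \<longleftrightarrow> is_L2_adjoint \<rho> \<rho> J J"

definition markov_kernel :: "'a measure \<Rightarrow> ('a \<Rightarrow> 'a measure) \<Rightarrow> bool" where
  "markov_kernel M K \<longleftrightarrow> K \<in> M \<rightarrow>\<^sub>M prob_algebra M"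

definition kernel_op :: "('a \<Rightarrow> 'a measure) \<Rightarrow> ('a \<Rightarrow> real) \<Rightarrow> ('a \<Rightarrow> real)" where
  "kernel_op K f w = (\<integral>w'. f w' \<partial>K w)"

definition reversible :: "'a measure \<Rightarrow> ('a \<Rightarrow> 'a measure) \<Rightarrow> bool" where
  "reversible \<rho> K \<longleftrightarrow> markov_kernel \<rho> K \<and> \<rho> \<bind> K = \<rho> \<and> self_adjoint \<rho> (kernel_op K)"

text \<open>The gap is extended-real valued because \<open>L\<^sub>0\<^sup>2(\<rho>)\<close> may be trivial (for instance for
  a point mass), in which case the infimum over the empty set is \<open>\<infinity>\<close>.\<close>

definition Gap :: "'a measure \<Rightarrow> (('a \<Rightarrow> real) \<Rightarrow> ('a \<Rightarrow> real)) \<Rightarrow> ereal" where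
  "Gap \<rho> J = (INF f \<in> {f \<in> L20 \<rho>. \<not> (AE x in \<rho>. f x = 0)}.
     ereal (((L2_norm \<rho> f)\<^sup>2 - L2_inner \<rho> f (J f)) / (L2_norm \<rho> f)\<^sup>2))"

definition hat_kernel ::
    "'z measure \<Rightarrow> ('z \<Rightarrow> 'y \<Rightarrow> 'y measure) \<Rightarrow> 'y \<times> 'z \<Rightarrow> ('y \<times> 'z) measure" where
  "hat_kernel Z Qz = (\<lambda>(y, z). Qz z y \<Otimes>\<^sub>M return Z z)"

definition E_op :: "('z \<Rightarrow> 'y measure) \<Rightarrow> ('y \<times> 'z \<Rightarrow> real) \<Rightarrow> ('z \<Rightarrow> real)" where
  "E_op \<nu> h z = (\<integral>y. h (y, z) \<partial>\<nu> z)"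

text \<open>\<open>E_star\<close> is a version of the adjoint of \<open>E_op \<nu>\<close> between \<open>L\<^sub>0\<^sup>2\<close> of
  \<open>\<nu>\<^sub>z(dy) \<omega>(dz)\<close> and \<open>L\<^sub>0\<^sup>2(\<omega>)\<close>.\<close>

definition E_star :: "('z \<Rightarrow> real) \<Rightarrow> ('y \<times> 'z \<Rightarrow> real)" where
  "E_star g = (\<lambda>(y, z). g z)"

end

(* For a Markov kernel K leaving M invariant, 2 (|h|^2 - <h, K h>) is the Dirichlet form
   D(K, h) = int int (h x - h y)^2 K(x, dy) M(dx), so bounds between kernels that hold only off the
   diagonal become bounds between gap numerators. Hypothesis (4) gives c0 * D(Qhat, h) <= D(Q, h).
   Both Qhat and E* E (the kernel that redraws y from the fibre measure over z) move only within a
   fibre, so D disintegrates over z and the fibrewise gap bound gives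
   kappa * D(E* E, h) <= D(Qhat, h). Passing from |P f|^2 to |f|^2 costs nothing since P is a
   contraction and c0, kappa <= 1. *)

theory Submission
  imports Defs
begin

text \<open>\<open>L2_adjoint\<close> is picked by \<open>SOME\<close>, so nothing is known about P*
  until some adjoint of \<open>P\<close> has been exhibited. This is why completeness of L2 and the
  Riesz representation come in; that \<open>P\<close> is a contraction supplies the boundedness
  which Riesz needs. Afterwards P* is used only through the defining property of an adjoint.

  Dirichlet forms take values in \<open>ennreal\<close>, so that almost-everywhere inequalities
  between their integrands can be integrated and disintegrated without integrability conditions. The
  price is that \<open>ennreal\<close> truncates negative reals to 0: returning to real gap
  numerators requires knowing that <h, K h> \<le> <h, h>.

  E* E is rewritten as \<open>hat_kernel\<close> of the fibre kernels that ignore y and redraw from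
  \<open>\<omega>z z\<close>. It is then built in the same way as Qhat, and one disintegration lemma
  serves both forms. On a single fibre the redrawing kernel sends centred functions to 0, so its
  Dirichlet form is twice the variance, and a bound on the gap of a fibre is a comparison with this
  form.\<close>

section \<open>Square-integrable functions and the Cauchy-Schwarz inequality\<close>

lemma L20_D:
  assumes "f \<in> L20 M"
  shows "f \<in> borel_measurable M" "integrable M (\<lambda>x. (f x)\<^sup>2)" "(\<integral>x. f x \<partial>M) = 0"
  using assms by (auto simp: L20_def)

lemma L2_norm_square: "(L2_norm M f)\<^sup>2 = L2_inner M f f"
  by (simp add: L2_norm_def L2_inner_def)

lemma L2_inner_cong_AE:
  assumes "AE x in M. f x = g x" "f \<in> borel_measurable M" "g \<in> borel_measurable M" "h \<in> borel_measurable M"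
  shows "L2_inner M h f = L2_inner M h g"
  unfolding L2_inner_def using assms by (intro integral_cong_AE) auto

lemma integrable_mult_of_square_integrable:
  fixes f g :: "'a \<Rightarrow> real"
  assumes [measurable]: "f \<in> borel_measurable M" "g \<in> borel_measurable M"
    and "integrable M (\<lambda>x. (f x)\<^sup>2)" "integrable M (\<lambda>x. (g x)\<^sup>2)"
  shows "integrable M (\<lambda>x. f x * g x)"
proof (rule Bochner_Integration.integrable_bound)
  show "integrable M (\<lambda>x. (f x)\<^sup>2 + (g x)\<^sup>2)" using assms by simp
  have "\<bar>a * b\<bar> \<le> a\<^sup>2 + b\<^sup>2" for a b :: real
  proof -
    have "2 * (\<bar>a\<bar> * \<bar>b\<bar>) \<le> a\<^sup>2 + b\<^sup>2"
      using sum_squares_bound[of "\<bar>a\<bar>" "\<bar>b\<bar>"] by (simp add: mult.assoc)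
    moreover have "0 \<le> \<bar>a\<bar> * \<bar>b\<bar>" by simp
    ultimately show ?thesis unfolding abs_mult by linarith
  qed
  then show "AE x in M. norm (f x * g x) \<le> norm ((f x)\<^sup>2 + (g x)\<^sup>2)" by simp
qed measurable

lemma square_integrable_add:
  fixes f g :: "'a \<Rightarrow> real"
  assumes "f \<in> borel_measurable M" "g \<in> borel_measurable M"
    and "integrable M (\<lambda>x. (f x)\<^sup>2)" "integrable M (\<lambda>x. (g x)\<^sup>2)"
  shows "integrable M (\<lambda>x. (f x + g x)\<^sup>2)"
  using assms integrable_mult_of_square_integrable[OF assms]
  by (simp add: power2_sum mult.assoc)

lemma square_integrable_scale:
  fixes f :: "'a \<Rightarrow> real"
  assumes "integrable M (\<lambda>x. (f x)\<^sup>2)"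
  shows "integrable M (\<lambda>x. (c * f x)\<^sup>2)"
  using assms by (simp add: power_mult_distrib)

lemma square_integrable_diff:
  fixes f g :: "'a \<Rightarrow> real"
  assumes "f \<in> borel_measurable M" "g \<in> borel_measurable M"
    and "integrable M (\<lambda>x. (f x)\<^sup>2)" "integrable M (\<lambda>x. (g x)\<^sup>2)"
  shows "integrable M (\<lambda>x. (f x - g x)\<^sup>2)"
  using square_integrable_add[of f M "\<lambda>x. - g x"] assms by simp

lemma (in prob_space) L20_integrable: "f \<in> L20 M \<Longrightarrow> integrable M f"
  by (rule square_integrable_imp_integrable) (simp_all add: L20_def)

lemma (in prob_space) L20_add:
  assumes f: "f \<in> L20 M" and g: "g \<in> L20 M"
  shows "(\<lambda>x. f x + g x) \<in> L20 M"
proof -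
  note L20_D(1)[OF f, measurable] L20_D(1)[OF g, measurable]
  show ?thesis
    using square_integrable_add[OF L20_D(1)[OF f] L20_D(1)[OF g] L20_D(2)[OF f] L20_D(2)[OF g]]
      L20_integrable[OF f] L20_integrable[OF g] L20_D(3)[OF f] L20_D(3)[OF g]
    unfolding L20_def by simp
qed

lemma L20_scale:
  assumes "f \<in> L20 M"
  shows "(\<lambda>x. c * f x) \<in> L20 M"
  using L20_D(1)[OF assms] L20_D(2)[OF assms, THEN square_integrable_scale] L20_D(3)[OF assms]
  unfolding L20_def by simp

lemma L2_inner_self_expand:
  fixes f g :: "'a \<Rightarrow> real"
  assumes "f \<in> borel_measurable M" "g \<in> borel_measurable M"
    and "integrable M (\<lambda>x. (f x)\<^sup>2)" "integrable M (\<lambda>x. (g x)\<^sup>2)"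
  shows "(\<integral>x. (f x + c * g x)\<^sup>2 \<partial>M) = (\<integral>x. (f x)\<^sup>2 \<partial>M) + 2 * c * L2_inner M f g + c\<^sup>2 * (\<integral>x. (g x)\<^sup>2 \<partial>M)"
proof -
  have "(f x + c * g x)\<^sup>2 = (f x)\<^sup>2 + (2 * c) * (f x * g x) + c\<^sup>2 * (g x)\<^sup>2" for x
    by (simp add: power2_eq_square algebra_simps)
  then show ?thesis
    using assms integrable_mult_of_square_integrable[OF assms] by (simp add: L2_inner_def)
qed

text \<open>First-order condition at a minimum, in the form in which the Riesz representation uses
  it.\<close>

lemma linear_coefficient_zero:
  fixes a G :: real
  assumes "\<And>t. 0 \<le> 2 * t * a + t\<^sup>2 * G" "0 \<le> G"
  shows "a = 0"
proof (rule ccontr)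
  assume "a \<noteq> 0"
  \<comment> \<open>The minimiser of the quadratic is \<open>- a / G\<close>; the added 1 keeps the
    denominator positive when \<open>G = 0\<close>.\<close>
  define t where "t = - a / (G + 1)"
  have a: "a = - t * (G + 1)" using assms(2) by (simp add: t_def field_simps)
  then have "t \<noteq> 0" using \<open>a \<noteq> 0\<close> by auto
  have "2 * t * a + t\<^sup>2 * G = - (t\<^sup>2 * (G + 2))"
    unfolding a by (simp add: power2_eq_square algebra_simps)
  moreover have "t\<^sup>2 * (G + 2) > 0" using \<open>t \<noteq> 0\<close> assms(2) by simp
  ultimately show False using assms(1)[of t] by linarith
qed

text \<open>The squared norm of f + c g is a nonnegative quadratic in c; its discriminant gives the
  bound.\<close>

lemma L2_Cauchy_Schwarz:
  fixes f g :: "'a \<Rightarrow> real"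
  assumes "f \<in> borel_measurable M" "g \<in> borel_measurable M"
    and "integrable M (\<lambda>x. (f x)\<^sup>2)" "integrable M (\<lambda>x. (g x)\<^sup>2)"
  shows "(L2_inner M f g)\<^sup>2 \<le> (\<integral>x. (f x)\<^sup>2 \<partial>M) * (\<integral>x. (g x)\<^sup>2 \<partial>M)"
proof -
  define A where "A = (\<integral>x. (f x)\<^sup>2 \<partial>M)"
  define B where "B = (\<integral>x. (g x)\<^sup>2 \<partial>M)"
  define I where "I = L2_inner M f g"
  have quad: "0 \<le> A + 2 * c * I + c\<^sup>2 * B" for c
    using L2_inner_self_expand[OF assms, of c] Bochner_Integration.integral_nonneg[of M "\<lambda>x. (f x + c * g x)\<^sup>2"]
    by (simp add: A_def B_def I_def)
  have B: "0 \<le> B" by (simp add: B_def)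
  show ?thesis
  proof (cases "B = 0")
    case True
    have "I = 0"
    proof (rule ccontr)
      assume "I \<noteq> 0"
      \<comment> \<open>With \<open>B = 0\<close> the quadratic is affine in \<open>c\<close>, and
        this \<open>c\<close> would give it the value -1.\<close>
      then have "A + 2 * (- (A + 1) / (2 * I)) * I = - 1" by (simp add: field_simps)
      then show False using quad[of "- (A + 1) / (2 * I)"] True by simp
    qed
    then show ?thesis using True by (simp add: A_def B_def I_def)
  next
    case False
    then have "B > 0" using B by simp
    \<comment> \<open>\<open>c = - I / B\<close> is the minimiser of the quadratic.\<close>
    have "0 \<le> B * (A + 2 * (- I / B) * I + (- I / B)\<^sup>2 * B)" using quad[of "- I / B"] B by simp
    also have "\<dots> = A * B - I\<^sup>2" using \<open>B > 0\<close> by (simp add: field_simps power2_eq_square)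
    finally show ?thesis by (simp add: A_def B_def I_def)
  qed
qed

section \<open>Completeness, Riesz representation and existence of the adjoint\<close>

text \<open>Cauchy-Schwarz against the constant 1. It serves twice: to pass from L2 to L1 increments
  in the completeness proof, and as Jensen's inequality for the measures \<open>K x\<close>.\<close>

lemma (in prob_space) integral_square_le:
  fixes f :: "'a \<Rightarrow> real"
  assumes "f \<in> borel_measurable M" "integrable M (\<lambda>x. (f x)\<^sup>2)"
  shows "(\<integral>x. f x \<partial>M)\<^sup>2 \<le> (\<integral>x. (f x)\<^sup>2 \<partial>M)"
  using L2_Cauchy_Schwarz[of f M "\<lambda>_. 1"] assms by (simp add: L2_inner_def prob_space)

text \<open>Completeness of \<open>L\<^sup>2\<close>: the geometric rate makes the sequence converge almost everywhere, and
  Fatou's lemma identifies the pointwise limit as the \<open>L\<^sup>2\<close> limit.\<close>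

lemma (in prob_space) L2_complete:
  fixes F :: "nat \<Rightarrow> 'a \<Rightarrow> real"
  assumes [measurable]: "\<And>n. F n \<in> borel_measurable M"
    and sq: "\<And>n. integrable M (\<lambda>x. (F n x)\<^sup>2)"
    and cauchy: "\<And>n k. n \<le> k \<Longrightarrow> (\<integral>x. (F n x - F k x)\<^sup>2 \<partial>M) \<le> C * (1/4)^n"
  obtains f where "f \<in> borel_measurable M" "integrable M (\<lambda>x. (f x)\<^sup>2)"
    "\<And>n. (\<integral>x. (F n x - f x)\<^sup>2 \<partial>M) \<le> C * (1/4)^n"
proof -
  have C: "0 \<le> C" using cauchy[of 0 0] by simp
  have sqd: "integrable M (\<lambda>x. (F n x - F k x)\<^sup>2)" for n k
    by (rule square_integrable_diff) (use sq in auto)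
  have int: "integrable M (\<lambda>x. F (Suc n) x - F n x)" for n
    using square_integrable_imp_integrable[OF _ sq[of n]] square_integrable_imp_integrable[OF _ sq[of "Suc n"]]
    by simp
  \<comment> \<open>The square root of the rate (1/4)^n is still summable, so the increments have a
    finite expected sum and are almost surely summable.\<close>
  have L1: "(\<integral>x. \<bar>F (Suc n) x - F n x\<bar> \<partial>M) \<le> sqrt C * (1/2)^n" for n
  proof -
    have "(\<integral>x. \<bar>F (Suc n) x - F n x\<bar> \<partial>M)\<^sup>2 \<le> (\<integral>x. (F (Suc n) x - F n x)\<^sup>2 \<partial>M)"
      using integral_square_le[of "\<lambda>x. \<bar>F (Suc n) x - F n x\<bar>"] sqd[of "Suc n" n] by simp
    also have "\<dots> \<le> C * (1/4)^n" using cauchy[of n "Suc n"] by (simp add: power2_commute)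
    also have "\<dots> = (sqrt C * (1/2)^n)\<^sup>2"
      using C by (simp add: power_mult_distrib power_divide flip: power_mult power2_eq_square)
        (simp add: power_mult mult.commute[of n])
    finally show ?thesis by (rule power2_le_imp_le) (use C in auto)
  qed
  have "(\<integral>\<^sup>+x. (\<Sum>n. ennreal \<bar>F (Suc n) x - F n x\<bar>) \<partial>M) = (\<Sum>n. \<integral>\<^sup>+x. ennreal \<bar>F (Suc n) x - F n x\<bar> \<partial>M)"
    by (rule nn_integral_suminf) measurable
  also have "\<dots> = (\<Sum>n. ennreal (\<integral>x. \<bar>F (Suc n) x - F n x\<bar> \<partial>M))"
    by (intro suminf_cong nn_integral_eq_integral) (use int in auto)
  also have "\<dots> \<le> (\<Sum>n. ennreal (sqrt C * (1/2)^n))"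
    by (intro suminf_le ennreal_leI L1) auto
  also have "\<dots> = ennreal (\<Sum>n. sqrt C * (1/2)^n)"
    by (rule suminf_ennreal2) (use C in \<open>auto intro!: summable_mult summable_geometric\<close>)
  also have "\<dots> < \<infinity>" by simp
  finally have "(\<integral>\<^sup>+x. (\<Sum>n. ennreal \<bar>F (Suc n) x - F n x\<bar>) \<partial>M) \<noteq> \<infinity>" by simp
  then have "AE x in M. (\<Sum>n. ennreal \<bar>F (Suc n) x - F n x\<bar>) \<noteq> \<infinity>"
    by (intro nn_integral_PInf_AE) auto
  then have conv: "AE x in M. convergent (\<lambda>n. F n x)"
  proof eventually_elim
    case (elim x)
    then have "summable (\<lambda>n. \<bar>F (Suc n) x - F n x\<bar>)"
      by (intro summable_suminf_not_top) auto
    then have "summable (\<lambda>n. F (Suc n) x - F n x)" by (rule summable_rabs_cancel)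
    then have "convergent (\<lambda>n. \<Sum>i<n. F (Suc i) x - F i x)" by (simp add: summable_iff_convergent)
    then have "convergent (\<lambda>n. F n x - F 0 x)" unfolding sum_lessThan_telescope[of "\<lambda>n. F n x"] .
    then show ?case using convergent_add[OF _ convergent_const[of "F 0 x"]] by fastforce
  qed
  define f where "f x = lim (\<lambda>n. F n x)" for x
  have f[measurable]: "f \<in> borel_measurable M" unfolding f_def by measurable
  have nn: "(\<integral>\<^sup>+x. ennreal ((F n x - f x)\<^sup>2) \<partial>M) \<le> ennreal (C * (1/4)^n)" for n
  proof -
    have "(\<integral>\<^sup>+x. ennreal ((F n x - f x)\<^sup>2) \<partial>M) = (\<integral>\<^sup>+x. liminf (\<lambda>k. ennreal ((F n x - F k x)\<^sup>2)) \<partial>M)"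
    proof (rule nn_integral_cong_AE, use conv in eventually_elim)
      case (elim x)
      then have "(\<lambda>k. F k x) \<longlonglongrightarrow> f x" by (simp add: f_def convergent_LIMSEQ_iff)
      then have "(\<lambda>k. ennreal ((F n x - F k x)\<^sup>2)) \<longlonglongrightarrow> ennreal ((F n x - f x)\<^sup>2)"
        by (intro tendsto_ennrealI tendsto_intros)
      then show ?case by (simp add: lim_imp_Liminf del: tendsto_ennreal_iff)
    qed
    also have "\<dots> \<le> liminf (\<lambda>k. \<integral>\<^sup>+x. ennreal ((F n x - F k x)\<^sup>2) \<partial>M)"
      by (rule nn_integral_liminf) measurable
    also have "\<dots> \<le> ennreal (C * (1/4)^n)"
    proof -
      have "eventually (\<lambda>k. (\<integral>\<^sup>+x. ennreal ((F n x - F k x)\<^sup>2) \<partial>M) \<le> ennreal (C * (1/4)^n)) sequentially"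
        using eventually_ge_at_top[of n]
        by eventually_elim (simp add: nn_integral_eq_integral[OF sqd] ennreal_leI cauchy)
      then have "liminf (\<lambda>k. \<integral>\<^sup>+x. ennreal ((F n x - F k x)\<^sup>2) \<partial>M) \<le> liminf (\<lambda>k::nat. ennreal (C * (1/4)^n))"
        by (rule Liminf_mono)
      then show ?thesis by (simp add: Liminf_const)
    qed
    finally show ?thesis .
  qed
  have fd: "integrable M (\<lambda>x. (F n x - f x)\<^sup>2)" for n
    by (rule integrableI_nonneg) (use nn[of n] in \<open>auto simp: le_less_trans[OF _ ennreal_less_top]\<close>)
  show thesis
  proof (rule that[OF f])
    show "integrable M (\<lambda>x. (f x)\<^sup>2)"
      \<comment> \<open>Here \<open>f\<close> is read as \<open>F 0 - (F 0 - f)\<close>.\<close>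
      using square_integrable_diff[OF _ _ sq fd, of 0 0] by simp
    show "(\<integral>x. (F n x - f x)\<^sup>2 \<partial>M) \<le> C * (1/4)^n" for n
      using nn[of n] C by (simp add: nn_integral_eq_integral[OF fd])
  qed
qed

lemma tendsto_of_square_geometric:
  fixes x :: "nat \<Rightarrow> real"
  assumes "\<And>n. (x n - l)\<^sup>2 \<le> C * (1/4)^n"
  shows "x \<longlonglongrightarrow> l"
proof -
  have "(\<lambda>n. C * (1/4)^n) \<longlonglongrightarrow> C * 0"
    by (intro tendsto_mult tendsto_const LIMSEQ_power_zero) simp
  then have "(\<lambda>n. C * (1/4)^n) \<longlonglongrightarrow> 0" by simp
  then have "(\<lambda>n. (x n - l)\<^sup>2) \<longlonglongrightarrow> 0"
    by (rule Lim_null_comparison[rotated]) (use assms in auto)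
  then have "(\<lambda>n. sqrt ((x n - l)\<^sup>2)) \<longlonglongrightarrow> sqrt 0" by (rule tendsto_real_sqrt)
  then have "(\<lambda>n. \<bar>x n - l\<bar>) \<longlonglongrightarrow> 0" by simp
  then have "(\<lambda>n. x n - l) \<longlonglongrightarrow> 0" by (rule tendsto_rabs_zero_cancel)
  then show ?thesis by (rule LIM_zero_cancel)
qed

text \<open>Riesz representation on \<open>L\<^sub>0\<^sup>2\<close>: the representing function is the minimiser of
  \<open>\<parallel>f\<parallel>\<^sup>2 - 2 \<phi> f\<close>; minimising sequences are Cauchy by the parallelogram law.\<close>

lemma (in prob_space) L20_Riesz:
  fixes \<phi> :: "('a \<Rightarrow> real) \<Rightarrow> real"
  assumes add: "\<And>f g. f \<in> L20 M \<Longrightarrow> g \<in> L20 M \<Longrightarrow> \<phi> (\<lambda>x. f x + g x) = \<phi> f + \<phi> g"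
    and scale: "\<And>f c. f \<in> L20 M \<Longrightarrow> \<phi> (\<lambda>x. c * f x) = c * \<phi> f"
    and "0 \<le> C" and bound: "\<And>f. f \<in> L20 M \<Longrightarrow> (\<phi> f)\<^sup>2 \<le> C * (\<integral>x. (f x)\<^sup>2 \<partial>M)"
  obtains f where "f \<in> L20 M" "\<And>g. g \<in> L20 M \<Longrightarrow> \<phi> g = L2_inner M g f"
proof -
  define \<Phi> where "\<Phi> f = (\<integral>x. (f x)\<^sup>2 \<partial>M) - 2 * \<phi> f" for f
  define m where "m = Inf (\<Phi> ` L20 M)"
  \<comment> \<open>If N - 2 \<phi> f < -C, squaring and the bound on \<phi> give (N + C)^2 < 4 C N,
    that is (N - C)^2 < 0.\<close>
  have "\<Phi> f \<ge> - C" if f: "f \<in> L20 M" for f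
  proof (rule ccontr)
    define N where "N = (\<integral>x. (f x)\<^sup>2 \<partial>M)"
    assume "\<not> \<Phi> f \<ge> - C"
    then have less: "N + C < 2 * \<phi> f" by (simp add: \<Phi>_def N_def)
    have N: "0 \<le> N" by (simp add: N_def)
    have b: "(\<phi> f)\<^sup>2 \<le> C * N" using bound[OF f] by (simp add: N_def)
    have "0 \<le> N + C" using N \<open>0 \<le> C\<close> by simp
    then have "(N + C)\<^sup>2 < (2 * \<phi> f)\<^sup>2" using less by (intro power_strict_mono) auto
    also have "\<dots> \<le> 4 * (C * N)" using b by (simp add: power_mult_distrib)
    finally have "(N - C)\<^sup>2 < 0" by (simp add: power2_eq_square algebra_simps)
    then show False by simp
  qed
  then have bdd: "bdd_below (\<Phi> ` L20 M)" by (auto intro!: bdd_belowI)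
  have "(\<lambda>_. 0) \<in> L20 M" by (simp add: L20_def)
  then have ne: "L20 M \<noteq> {}" by blast
  have m_le: "m \<le> \<Phi> f" if "f \<in> L20 M" for f
    unfolding m_def using bdd that by (intro cINF_lower) auto
  \<comment> \<open>The tolerance (1/4)^n is chosen to match the rate in
    \<open>L2_complete\<close>.\<close>
  have "\<exists>f\<in>L20 M. \<Phi> f < m + (1/4)^n" for n :: nat
    using cINF_less_iff[OF ne bdd, of "m + (1/4)^n"] by (simp add: m_def)
  then obtain F where F: "\<And>n. F n \<in> L20 M" and F_less: "\<And>n. \<Phi> (F n) < m + (1/4)^n"
    by metis
  note meas = L20_D(1)[OF F]
  note sq = L20_D(2)[OF F]
  \<comment> \<open>The midpoint \<open>h\<close> has \<open>\<Phi> h \<ge> m\<close>. The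
    parallelogram identity then leaves at most twice each of the two tolerances, hence the 4 when
    \<open>n \<le> k\<close>.\<close>
  have cauchy: "(\<integral>x. (F n x - F k x)\<^sup>2 \<partial>M) \<le> 4 * (1/4)^n" if "n \<le> k" for n k
  proof -
    define h where "h = (\<lambda>x. (1/2) * (F n x + F k x))"
    have h: "h \<in> L20 M" unfolding h_def by (intro L20_scale L20_add F)
    have "\<phi> h = (\<phi> (F n) + \<phi> (F k)) / 2"
      unfolding h_def by (simp add: scale add F L20_add del: times_divide_eq_left)
    moreover have "(\<integral>x. (h x)\<^sup>2 \<partial>M) = (\<integral>x. (1/2) * (F n x)\<^sup>2 + (1/2) * (F k x)\<^sup>2 - (1/4) * (F n x - F k x)\<^sup>2 \<partial>M)"
      unfolding h_def by (intro Bochner_Integration.integral_cong refl) (simp add: power2_eq_square field_simps)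
    moreover have "\<dots> = (\<integral>x. (F n x)\<^sup>2 \<partial>M) / 2 + (\<integral>x. (F k x)\<^sup>2 \<partial>M) / 2 - (\<integral>x. (F n x - F k x)\<^sup>2 \<partial>M) / 4"
      using sq square_integrable_diff[OF meas meas sq sq, of n k] by simp
    ultimately have "(\<integral>x. (F n x - F k x)\<^sup>2 \<partial>M) = 2 * \<Phi> (F n) + 2 * \<Phi> (F k) - 4 * \<Phi> h"
      by (simp add: \<Phi>_def field_simps)
    moreover have "(1/4::real)^k \<le> (1/4)^n" using that by (intro power_decreasing) auto
    ultimately show ?thesis using F_less[of n] F_less[of k] m_le[OF h] by linarith
  qed
  obtain f where f[measurable]: "f \<in> borel_measurable M" and f2: "integrable M (\<lambda>x. (f x)\<^sup>2)"
    and lim: "\<And>n. (\<integral>x. (F n x - f x)\<^sup>2 \<partial>M) \<le> 4 * (1/4)^n"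
    using L2_complete[OF meas sq cauchy] by blast
  have diff_meas: "(\<lambda>x. F n x - f x) \<in> borel_measurable M" for n using meas[of n] by measurable
  have diff_sq: "integrable M (\<lambda>x. (F n x - f x)\<^sup>2)" for n
    by (rule square_integrable_diff[OF meas f sq f2])
  \<comment> \<open>Not restricted to \<open>g\<close> in \<open>L20 M\<close>: it is also applied
    to the constant 1, to see that the limit again has mean zero.\<close>
  have inner_lim: "(\<lambda>n. L2_inner M (F n) g) \<longlonglongrightarrow> L2_inner M f g"
    if g: "g \<in> borel_measurable M" "integrable M (\<lambda>x. (g x)\<^sup>2)" for g
  proof (rule tendsto_of_square_geometric)
    fix n
    have "L2_inner M (F n) g - L2_inner M f g = L2_inner M (\<lambda>x. F n x - f x) g"
      using integrable_mult_of_square_integrable[OF meas g(1) sq g(2), of n]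
        integrable_mult_of_square_integrable[OF f g(1) f2 g(2)]
      by (simp add: L2_inner_def left_diff_distrib)
    then have "(L2_inner M (F n) g - L2_inner M f g)\<^sup>2 \<le> (\<integral>x. (F n x - f x)\<^sup>2 \<partial>M) * (\<integral>x. (g x)\<^sup>2 \<partial>M)"
      using L2_Cauchy_Schwarz[OF diff_meas g(1) diff_sq g(2), of n] by simp
    also have "\<dots> \<le> (4 * (1/4)^n) * (\<integral>x. (g x)\<^sup>2 \<partial>M)"
      by (intro mult_right_mono lim) simp
    finally show "(L2_inner M (F n) g - L2_inner M f g)\<^sup>2 \<le> (4 * (\<integral>x. (g x)\<^sup>2 \<partial>M)) * (1/4)^n"
      by (simp add: mult_ac)
  qed
  have "(\<lambda>n. L2_inner M (F n) (\<lambda>_. 1)) \<longlonglongrightarrow> L2_inner M f (\<lambda>_. 1)" by (rule inner_lim) auto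
  moreover have "L2_inner M (F n) (\<lambda>_. 1) = 0" for n using L20_D(3)[OF F] by (simp add: L2_inner_def)
  ultimately have "L2_inner M f (\<lambda>_. 1) = 0" by (simp add: LIMSEQ_const_iff)
  then have "(\<integral>x. f x \<partial>M) = 0" by (simp add: L2_inner_def)
  then have fL: "f \<in> L20 M" using f f2 by (simp add: L20_def)
  show thesis
  proof (rule that[OF fL])
    fix g assume g: "g \<in> L20 M"
    define G where "G = (\<integral>x. (g x)\<^sup>2 \<partial>M)"
    \<comment> \<open>The variation is made at \<open>F n\<close> rather than at \<open>f\<close>.
      Only inner products with the fixed \<open>g\<close> then have to pass to the limit, and the
      value of \<open>\<Phi>\<close> at \<open>f\<close> never has to be computed.\<close>
    have "0 \<le> 2 * t * (L2_inner M f g - \<phi> g) + t\<^sup>2 * G" for t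
    proof -
      have "- ((1/4)^n) \<le> 2 * t * (L2_inner M (F n) g - \<phi> g) + t\<^sup>2 * G" for n
      proof -
        have "(\<lambda>x. F n x + t * g x) \<in> L20 M" by (intro L20_add L20_scale F g)
        then have "m \<le> \<Phi> (\<lambda>x. F n x + t * g x)" by (rule m_le)
        also have "\<dots> = \<Phi> (F n) + 2 * t * (L2_inner M (F n) g - \<phi> g) + t\<^sup>2 * G"
          unfolding \<Phi>_def L2_inner_self_expand[OF meas L20_D(1)[OF g] sq L20_D(2)[OF g]]
            add[OF F L20_scale[OF g]] scale[OF g] G_def by (simp add: algebra_simps)
        finally show ?thesis using F_less[of n] by linarith
      qed
      moreover have "(\<lambda>n. - ((1/4::real)^n)) \<longlonglongrightarrow> - 0"
        by (intro tendsto_minus LIMSEQ_power_zero) simp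
      moreover have "(\<lambda>n. 2 * t * (L2_inner M (F n) g - \<phi> g) + t\<^sup>2 * G)
          \<longlonglongrightarrow> 2 * t * (L2_inner M f g - \<phi> g) + t\<^sup>2 * G"
        by (intro tendsto_intros inner_lim L20_D[OF g])
      ultimately show ?thesis using LIMSEQ_le[of "\<lambda>n. - ((1/4::real)^n)" "- 0"] by fastforce
    qed
    then have "L2_inner M f g - \<phi> g = 0"
      by (rule linear_coefficient_zero) (simp add: G_def)
    then show "\<phi> g = L2_inner M g f" by (simp add: L2_inner_def mult.commute)
  qed
qed

text \<open>For fixed \<open>g\<close>, the functional sending \<open>f\<close> to <T f, g> is
  linear and, by Cauchy-Schwarz and the contraction property, bounded with squared norm at most that
  of \<open>g\<close>. Riesz supplies the value of an adjoint at \<open>g\<close>, and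
  \<open>SOME\<close> must then return an adjoint too.\<close>

lemma is_L2_adjoint_L2_adjoint:
  assumes "prob_space \<rho>" and lin: "L20_linear \<rho> \<sigma> T"
    and contr: "\<And>f. f \<in> L20 \<rho> \<Longrightarrow> L2_norm \<sigma> (T f) \<le> L2_norm \<rho> f"
  shows "is_L2_adjoint \<rho> \<sigma> T (L2_adjoint \<rho> \<sigma> T)"
proof -
  interpret prob_space \<rho> by fact
  have T: "T f \<in> L20 \<sigma>" if "f \<in> L20 \<rho>" for f using lin that by (simp add: L20_linear_def)
  have "\<exists>h. h \<in> L20 \<rho> \<and> (\<forall>f\<in>L20 \<rho>. L2_inner \<sigma> (T f) g = L2_inner \<rho> f h)" if g: "g \<in> L20 \<sigma>" for g
  proof (rule L20_Riesz[of "\<lambda>f. L2_inner \<sigma> (T f) g" "\<integral>x. (g x)\<^sup>2 \<partial>\<sigma>"])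
    note [measurable] = L20_D(1)[OF g]
    show "L2_inner \<sigma> (T (\<lambda>x. f x + f' x)) g = L2_inner \<sigma> (T f) g + L2_inner \<sigma> (T f') g"
      if f: "f \<in> L20 \<rho>" and f': "f' \<in> L20 \<rho>" for f f'
    proof -
      note [measurable] = L20_D(1)[OF T[OF f]] L20_D(1)[OF T[OF f']] L20_D(1)[OF T[OF L20_add[OF f f']]]
      have "AE y in \<sigma>. T (\<lambda>x. f x + f' x) y = T f y + T f' y"
        using lin f f' by (simp add: L20_linear_def)
      then have "L2_inner \<sigma> (T (\<lambda>x. f x + f' x)) g = (\<integral>y. T f y * g y + T f' y * g y \<partial>\<sigma>)"
        unfolding L2_inner_def by (intro integral_cong_AE) (auto simp: distrib_right)
      also have "\<dots> = L2_inner \<sigma> (T f) g + L2_inner \<sigma> (T f') g"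
        unfolding L2_inner_def
        by (intro Bochner_Integration.integral_add integrable_mult_of_square_integrable L20_D T f f' g)
      finally show ?thesis .
    qed
    show "L2_inner \<sigma> (T (\<lambda>x. c * f x)) g = c * L2_inner \<sigma> (T f) g" if f: "f \<in> L20 \<rho>" for f c
    proof -
      note [measurable] = L20_D(1)[OF T[OF f]] L20_D(1)[OF T[OF L20_scale[OF f]]]
      have "AE y in \<sigma>. T (\<lambda>x. c * f x) y = c * T f y"
        using lin f by (simp add: L20_linear_def)
      then have "L2_inner \<sigma> (T (\<lambda>x. c * f x)) g = (\<integral>y. c * (T f y * g y) \<partial>\<sigma>)"
        unfolding L2_inner_def by (intro integral_cong_AE) (auto simp: mult.assoc)
      then show ?thesis by (simp add: L2_inner_def)
    qed
    show "(L2_inner \<sigma> (T f) g)\<^sup>2 \<le> (\<integral>x. (g x)\<^sup>2 \<partial>\<sigma>) * (\<integral>x. (f x)\<^sup>2 \<partial>\<rho>)" if f: "f \<in> L20 \<rho>" for f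
    proof -
      have "(L2_norm \<sigma> (T f))\<^sup>2 \<le> (L2_norm \<rho> f)\<^sup>2"
        by (intro power_mono contr f) (simp add: L2_norm_def L2_inner_def)
      then have "(\<integral>x. (T f x)\<^sup>2 \<partial>\<sigma>) \<le> (\<integral>x. (f x)\<^sup>2 \<partial>\<rho>)"
        unfolding L2_norm_square by (simp add: L2_inner_def power2_eq_square)
      then have "(\<integral>x. (T f x)\<^sup>2 \<partial>\<sigma>) * (\<integral>x. (g x)\<^sup>2 \<partial>\<sigma>) \<le> (\<integral>x. (f x)\<^sup>2 \<partial>\<rho>) * (\<integral>x. (g x)\<^sup>2 \<partial>\<sigma>)"
        by (intro mult_right_mono) simp_all
      then show ?thesis
        using L2_Cauchy_Schwarz[OF L20_D(1)[OF T[OF f]] L20_D(1)[OF g] L20_D(2)[OF T[OF f]] L20_D(2)[OF g]]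
        by (simp add: mult.commute)
    qed
  qed (simp, blast)
  then obtain T' where "\<forall>g\<in>L20 \<sigma>. T' g \<in> L20 \<rho> \<and> (\<forall>f\<in>L20 \<rho>. L2_inner \<sigma> (T f) g = L2_inner \<rho> f (T' g))"
    by metis
  then have "is_L2_adjoint \<rho> \<sigma> T T'" by (auto simp: is_L2_adjoint_def)
  then show ?thesis unfolding L2_adjoint_def by (rule someI[of "is_L2_adjoint \<rho> \<sigma> T" T'])
qed

section \<open>Invariant kernels and their Dirichlet forms\<close>

text \<open>Twice the usual Dirichlet form, since the customary factor 1/2 is left out. As an
  \<open>ennreal\<close> it makes sense for every measurable function.\<close>

definition dirichlet :: "'a measure \<Rightarrow> ('a \<Rightarrow> 'a measure) \<Rightarrow> ('a \<Rightarrow> real) \<Rightarrow> ennreal" where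
  "dirichlet M K h = (\<integral>\<^sup>+x. \<integral>\<^sup>+y. ennreal ((h x - h y)\<^sup>2) \<partial>K x \<partial>M)"

locale invariant_kernel = prob_space M for M :: "'a measure" +
  fixes K :: "'a \<Rightarrow> 'a measure"
  assumes kernel: "markov_kernel M K" and invariant: "M \<bind> K = M"
begin

lemma kernel_subprob [measurable]: "K \<in> M \<rightarrow>\<^sub>M subprob_algebra M"
  using kernel measurable_prob_algebraD unfolding markov_kernel_def by blast

lemma
  assumes "x \<in> space M"
  shows prob_space_kernel: "prob_space (K x)" and sets_kernel_eq: "sets (K x) = sets M"
  using measurable_space[OF kernel[unfolded markov_kernel_def] assms] by (auto simp: space_prob_algebra)

lemma nn_integral_kernel:
  assumes "f \<in> borel_measurable M"
  shows "(\<integral>\<^sup>+x. \<integral>\<^sup>+y. f y \<partial>K x \<partial>M) = (\<integral>\<^sup>+x. f x \<partial>M)"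
  using nn_integral_bind[OF assms kernel_subprob] invariant by simp

lemma borel_measurable_kernel_op [measurable]:
  assumes [measurable]: "f \<in> borel_measurable M"
  shows "kernel_op K f \<in> borel_measurable M"
  unfolding kernel_op_def by (rule measurable_compose[OF kernel_subprob integral_measurable_subprob_algebra]) measurable

text \<open>By invariance the \<open>K x\<close>-integral of |f| has finite \<open>M\<close>-mean,
  so it is finite almost everywhere. Elsewhere \<open>kernel_op\<close> may take the default value 0
  of a non-integrable integral, which is why pointwise identities for it hold only almost
  everywhere.\<close>

lemma integrable_kernel:
  fixes f :: "'a \<Rightarrow> real"
  assumes f: "integrable M f"
  shows "AE x in M. integrable (K x) f"
proof -
  note [measurable] = borel_measurable_integrable[OF f]
  have "(\<integral>\<^sup>+x. ennreal (norm (f x)) \<partial>M) < \<infinity>"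
    using f unfolding integrable_iff_bounded by blast
  then have "(\<integral>\<^sup>+x. \<integral>\<^sup>+y. ennreal (norm (f y)) \<partial>K x \<partial>M) \<noteq> \<infinity>"
    by (simp add: nn_integral_kernel less_top)
  then have "AE x in M. (\<integral>\<^sup>+y. ennreal (norm (f y)) \<partial>K x) \<noteq> \<infinity>"
    by (intro nn_integral_PInf_AE measurable_compose[OF kernel_subprob nn_integral_measurable_subprob_algebra]) auto
  with AE_space show ?thesis
  proof eventually_elim
    case (elim x)
    then show ?case
      by (simp add: integrable_iff_bounded less_top measurable_cong_sets[OF sets_kernel_eq[OF elim(1)] refl])
  qed
qed

text \<open>Nonnegative functions come first because both claims can be read off from
  \<open>nn_integral_kernel\<close>, where integrability is no issue.\<close>

lemma kernel_op_nonneg: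
  assumes f: "integrable M f" and nn: "\<And>x. 0 \<le> f x"
  shows "integrable M (kernel_op K f)" "(\<integral>x. kernel_op K f x \<partial>M) = (\<integral>x. f x \<partial>M)"
proof -
  note [measurable] = borel_measurable_integrable[OF f]
  have "(\<integral>\<^sup>+x. ennreal (kernel_op K f x) \<partial>M) = (\<integral>\<^sup>+x. \<integral>\<^sup>+y. ennreal (f y) \<partial>K x \<partial>M)"
    by (rule nn_integral_cong_AE, use integrable_kernel[OF f] in eventually_elim)
       (simp add: kernel_op_def nn_integral_eq_integral nn)
  also have "\<dots> = ennreal (\<integral>x. f x \<partial>M)" by (simp add: nn_integral_kernel nn_integral_eq_integral f nn)
  finally have eq: "(\<integral>\<^sup>+x. ennreal (kernel_op K f x) \<partial>M) = ennreal (\<integral>x. f x \<partial>M)" .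
  have nn': "0 \<le> kernel_op K f x" for x by (simp add: kernel_op_def nn)
  show "integrable M (kernel_op K f)"
    by (rule integrableI_nonneg) (simp_all add: eq nn')
  show "(\<integral>x. kernel_op K f x \<partial>M) = (\<integral>x. f x \<partial>M)"
    by (subst integral_eq_nn_integral) (simp_all add: eq nn' nn)
qed

lemma
  fixes f :: "'a \<Rightarrow> real"
  assumes f: "integrable M f"
  shows integrable_kernel_op: "integrable M (kernel_op K f)"
    and integral_kernel_op: "(\<integral>x. kernel_op K f x \<partial>M) = (\<integral>x. f x \<partial>M)"
proof -
  note [measurable] = borel_measurable_integrable[OF f]
  \<comment> \<open>Two nonnegative integrable functions with difference \<open>f\<close>.\<close>
  define u where "u x = \<bar>f x\<bar> + f x" for x
  define v where "v x = \<bar>f x\<bar>" for x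
  have u: "integrable M u" "\<And>x. 0 \<le> u x" and v: "integrable M v" "\<And>x. 0 \<le> v x"
    using f by (auto simp: u_def[abs_def] v_def[abs_def])
  have f_eq: "f = (\<lambda>x. u x - v x)" by (auto simp: u_def v_def)
  have eq: "AE x in M. kernel_op K f x = kernel_op K u x - kernel_op K v x"
    using integrable_kernel[OF u(1)] integrable_kernel[OF v(1)]
    by eventually_elim (simp add: kernel_op_def f_eq)
  have int: "integrable M (\<lambda>x. kernel_op K u x - kernel_op K v x)"
    using kernel_op_nonneg(1)[OF u] kernel_op_nonneg(1)[OF v] by simp
  show "integrable M (kernel_op K f)"
    using int by (subst integrable_cong_AE[OF _ _ eq]) (use int in auto)
  have "(\<integral>x. kernel_op K f x \<partial>M) = (\<integral>x. kernel_op K u x - kernel_op K v x \<partial>M)"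
    by (rule integral_cong_AE[OF _ _ eq]) (use int in auto)
  also have "\<dots> = (\<integral>x. u x \<partial>M) - (\<integral>x. v x \<partial>M)"
    using kernel_op_nonneg[OF u] kernel_op_nonneg[OF v] by simp
  also have "\<dots> = (\<integral>x. f x \<partial>M)" unfolding f_eq using u v by simp
  finally show "(\<integral>x. kernel_op K f x \<partial>M) = (\<integral>x. f x \<partial>M)" .
qed

text \<open>Jensen's inequality for \<open>K x\<close>; integrated against the invariant measure it
  makes the operator a contraction of L2.\<close>

lemma kernel_op_square_le:
  assumes f: "f \<in> borel_measurable M" "integrable M (\<lambda>x. (f x)\<^sup>2)"
  shows "AE x in M. (kernel_op K f x)\<^sup>2 \<le> kernel_op K (\<lambda>x. (f x)\<^sup>2) x"
  using AE_space integrable_kernel[OF f(2)]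
proof eventually_elim
  case (elim x)
  interpret Kx: prob_space "K x" by (rule prob_space_kernel[OF elim(1)])
  show ?case
    unfolding kernel_op_def
    by (rule Kx.integral_square_le)
       (use f elim in \<open>simp_all add: measurable_cong_sets[OF sets_kernel_eq[OF elim(1)] refl]\<close>)
qed

lemma square_integrable_kernel_op:
  assumes f: "f \<in> borel_measurable M" "integrable M (\<lambda>x. (f x)\<^sup>2)"
  shows "integrable M (\<lambda>x. (kernel_op K f x)\<^sup>2)"
proof (rule Bochner_Integration.integrable_bound[OF integrable_kernel_op[OF f(2)]])
  note [measurable] = f(1)
  show "(\<lambda>x. (kernel_op K f x)\<^sup>2) \<in> borel_measurable M" by measurable
  show "AE x in M. norm ((kernel_op K f x)\<^sup>2) \<le> norm (kernel_op K (\<lambda>x. (f x)\<^sup>2) x)"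
    using kernel_op_square_le[OF f] by eventually_elim auto
qed

lemma kernel_op_L20:
  assumes f: "f \<in> L20 M"
  shows "kernel_op K f \<in> L20 M"
  using borel_measurable_kernel_op[OF L20_D(1)[OF f]] square_integrable_kernel_op[OF L20_D(1,2)[OF f]]
    integral_kernel_op[OF L20_integrable[OF f]] L20_D(3)[OF f]
  unfolding L20_def by simp

text \<open>Expanding the square under \<open>K x\<close>, a probability measure, gives the
  integrand \<open>D\<close>. Invariance turns the mean of its last term into that of h^2, so the
  two square terms together give 2 <h, h>.\<close>

lemma dirichlet_eq:
  assumes h: "h \<in> borel_measurable M" "integrable M (\<lambda>x. (h x)\<^sup>2)"
  shows "dirichlet M K h = ennreal (2 * (L2_inner M h h - L2_inner M h (kernel_op K h)))"
proof -
  note [measurable] = h(1)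
  define D where "D x = (h x)\<^sup>2 - 2 * (h x * kernel_op K h x) + kernel_op K (\<lambda>x. (h x)\<^sup>2) x" for x
  note hK = integrable_mult_of_square_integrable[OF h(1) borel_measurable_kernel_op[OF h(1)] h(2)
      square_integrable_kernel_op[OF h]]
  have D_int: "integrable M D"
    unfolding D_def using h(2) hK integrable_kernel_op[OF h(2)] by simp
  have ae: "AE x in M. (\<integral>\<^sup>+y. ennreal ((h x - h y)\<^sup>2) \<partial>K x) = ennreal (D x) \<and> 0 \<le> D x"
    using AE_space integrable_kernel[OF h(2)]
  proof eventually_elim
    case (elim x)
    interpret Kx: prob_space "K x" by (rule prob_space_kernel[OF elim(1)])
    have hx: "h \<in> borel_measurable (K x)"
      using h by (simp add: measurable_cong_sets[OF sets_kernel_eq[OF elim(1)] refl])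
    have ix: "integrable (K x) h" by (rule Kx.square_integrable_imp_integrable[OF hx elim(2)])
    have eq: "(h x - h y)\<^sup>2 = (h x)\<^sup>2 - 2 * h x * h y + (h y)\<^sup>2" for y by (simp add: power2_diff)
    have "integrable (K x) (\<lambda>y. (h x - h y)\<^sup>2)" unfolding eq using ix elim(2) by simp
    moreover have "(\<integral>y. (h x - h y)\<^sup>2 \<partial>K x) = D x"
      unfolding eq D_def kernel_op_def using ix elim(2) by (simp add: Kx.prob_space)
    ultimately show ?case
      by (metis Bochner_Integration.integral_nonneg nn_integral_eq_integral AE_I2 zero_le_power2)
  qed
  have "dirichlet M K h = (\<integral>\<^sup>+x. ennreal (D x) \<partial>M)"
    unfolding dirichlet_def by (rule nn_integral_cong_AE, use ae in eventually_elim) simp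
  also have "\<dots> = ennreal (\<integral>x. D x \<partial>M)"
    by (rule nn_integral_eq_integral[OF D_int], use ae in eventually_elim) simp
  also have "(\<integral>x. D x \<partial>M) = 2 * (L2_inner M h h - L2_inner M h (kernel_op K h))"
    unfolding D_def using h(2) hK integrable_kernel_op[OF h(2)] integral_kernel_op[OF h(2)]
    by (simp add: L2_inner_def power2_eq_square)
  finally show ?thesis .
qed

lemma borel_measurable_dirichlet_density:
  assumes [measurable]: "h \<in> borel_measurable M"
  shows "(\<lambda>x. \<integral>\<^sup>+y. ennreal ((h x - h y)\<^sup>2) \<partial>K x) \<in> borel_measurable M"
  by (rule nn_integral_measurable_subprob_algebra2[OF _ kernel_subprob]) measurable

text \<open>2 h Kh \<le> h^2 + (Kh)^2 \<le> h^2 + K(h^2), and the last two summands have equal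
  means. This cannot be extracted from \<open>dirichlet_eq\<close>, because \<open>ennreal\<close>
  of a negative number is 0.\<close>

lemma inner_kernel_op_le:
  assumes h: "h \<in> borel_measurable M" "integrable M (\<lambda>x. (h x)\<^sup>2)"
  shows "L2_inner M h (kernel_op K h) \<le> L2_inner M h h"
proof -
  note hK = integrable_mult_of_square_integrable[OF h(1) borel_measurable_kernel_op[OF h(1)] h(2)
      square_integrable_kernel_op[OF h]]
  have "2 * (\<integral>x. h x * kernel_op K h x \<partial>M) = (\<integral>x. 2 * (h x * kernel_op K h x) \<partial>M)" by simp
  also have "\<dots> \<le> (\<integral>x. (h x)\<^sup>2 + kernel_op K (\<lambda>x. (h x)\<^sup>2) x \<partial>M)"
  proof (rule integral_mono_AE)
    show "AE x in M. 2 * (h x * kernel_op K h x) \<le> (h x)\<^sup>2 + kernel_op K (\<lambda>x. (h x)\<^sup>2) x"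
      using kernel_op_square_le[OF h]
    proof eventually_elim
      case (elim x)
      have "2 * (h x * kernel_op K h x) \<le> (h x)\<^sup>2 + (kernel_op K h x)\<^sup>2"
        using sum_squares_bound[of "h x" "kernel_op K h x"] by (simp add: mult.assoc)
      then show ?case using elim by linarith
    qed
  qed (use h(2) hK integrable_kernel_op[OF h(2)] in auto)
  also have "\<dots> = 2 * (\<integral>x. (h x)\<^sup>2 \<partial>M)"
    using h(2) integrable_kernel_op[OF h(2)] integral_kernel_op[OF h(2)] by simp
  finally show ?thesis by (simp add: L2_inner_def power2_eq_square)
qed

end

lemma reversible_invariant_kernel:
  "prob_space M \<Longrightarrow> reversible M K \<Longrightarrow> invariant_kernel M K"
  by (simp add: invariant_kernel_def invariant_kernel_axioms_def reversible_def)

text \<open>Independent resampling from \<open>M\<close>. Its operator is the expectation; on a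
  single fibre this is what E* E does.\<close>

lemma invariant_kernel_const:
  assumes "prob_space M"
  shows "invariant_kernel M (\<lambda>_. M)"
proof -
  interpret prob_space M by fact
  show ?thesis
  proof
    show "markov_kernel M (\<lambda>_. M)"
      unfolding markov_kernel_def by (rule measurable_const) (simp add: space_prob_algebra prob_space_axioms)
    show "M \<bind> (\<lambda>_. M) = M"
      by (rule bind_const') (simp_all add: prob_space_axioms prob_space_imp_subprob_space)
  qed
qed

section \<open>From Dirichlet forms to spectral gaps and back\<close>

lemma inner_gap_le_of_dirichlet_le:
  assumes K: "invariant_kernel M K" and K': "invariant_kernel M K'" and c: "0 \<le> c"
    and h: "h \<in> borel_measurable M" "integrable M (\<lambda>x. (h x)\<^sup>2)"
    and le: "ennreal c * dirichlet M K h \<le> dirichlet M K' h"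
  shows "c * (L2_inner M h h - L2_inner M h (kernel_op K h)) \<le> L2_inner M h h - L2_inner M h (kernel_op K' h)"
proof -
  \<comment> \<open>An inequality in \<open>ennreal\<close> reflects to the reals as soon as its
    right-hand side is not truncated.\<close>
  have nonneg: "0 \<le> L2_inner M h h - L2_inner M h (kernel_op K' h)"
    using invariant_kernel.inner_kernel_op_le[OF K' h] by simp
  have "ennreal (c * (2 * (L2_inner M h h - L2_inner M h (kernel_op K h))))
      \<le> ennreal (2 * (L2_inner M h h - L2_inner M h (kernel_op K' h)))"
    using le unfolding invariant_kernel.dirichlet_eq[OF K h] invariant_kernel.dirichlet_eq[OF K' h]
    by (simp add: ennreal_mult'[OF c])
  then have "c * (2 * (L2_inner M h h - L2_inner M h (kernel_op K h)))
      \<le> 2 * (L2_inner M h h - L2_inner M h (kernel_op K' h))"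
    using nonneg by (subst (asm) ennreal_le_iff) auto
  then show ?thesis by (simp add: right_diff_distrib)
qed

text \<open>Compares Rayleigh quotients function by function. If \<open>L20 M\<close> is trivial,
  the right-hand gap is the infinite infimum over the empty set, so nothing remains to be
  shown.\<close>

lemma Gap_mono_scaled:
  assumes c: "0 \<le> c"
    and le: "\<And>f. f \<in> L20 M \<Longrightarrow>
      c * (L2_inner M f f - L2_inner M f (J f)) \<le> L2_inner M f f - L2_inner M f (J' f)"
  shows "ereal c * Gap M J \<le> Gap M J'"
  unfolding Gap_def[of M J'] L2_norm_square
proof (rule INF_greatest)
  fix f assume f: "f \<in> {f \<in> L20 M. \<not> (AE x in M. f x = 0)}"
  have "Gap M J \<le> ereal ((L2_inner M f f - L2_inner M f (J f)) / L2_inner M f f)"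
    unfolding Gap_def L2_norm_square by (rule INF_lower) (use f in simp)
  then have "ereal c * Gap M J \<le> ereal c * ereal ((L2_inner M f f - L2_inner M f (J f)) / L2_inner M f f)"
    using c by (intro ereal_mult_left_mono) auto
  also have "\<dots> = ereal (c * (L2_inner M f f - L2_inner M f (J f)) / L2_inner M f f)" by simp
  also have "\<dots> \<le> ereal ((L2_inner M f f - L2_inner M f (J' f)) / L2_inner M f f)"
    using le f by (simp only: ereal_less_eq, intro divide_right_mono) (auto simp: L2_inner_def)
  finally show "ereal c * Gap M J \<le> ereal ((L2_inner M f f - L2_inner M f (J' f)) / L2_inner M f f)" .
qed

text \<open>Both Dirichlet forms ignore constants, so the spectral gap on \<open>L\<^sub>0\<^sup>2\<close> controls every
  square integrable function.\<close>

lemma poincare_of_Gap: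
  assumes M: "prob_space M" and K: "invariant_kernel M K"
    and gap: "ereal \<kappa> \<le> Gap M (kernel_op K)"
    and h: "h \<in> borel_measurable M" "integrable M (\<lambda>x. (h x)\<^sup>2)"
  shows "ennreal \<kappa> * dirichlet M (\<lambda>_. M) h \<le> dirichlet M K h"
proof (cases "0 \<le> \<kappa>")
  case True
  interpret prob_space M by fact
  interpret K: invariant_kernel M K by fact
  interpret C: invariant_kernel M "\<lambda>_. M" by (rule invariant_kernel_const) fact
  \<comment> \<open>Centring moves \<open>h\<close> into \<open>L20 M\<close> without changing
    either Dirichlet form.\<close>
  define g where "g x = h x - (\<integral>x. h x \<partial>M)" for x
  have hi: "integrable M h" by (rule square_integrable_imp_integrable[OF h])
  have g: "g \<in> L20 M"
    using h hi square_integrable_diff[OF h(1) _ h(2), of "\<lambda>_. \<integral>x. h x \<partial>M"]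
    unfolding L20_def g_def by (simp add: prob_space)
  note g' = L20_D(1,2)[OF g]
  have "dirichlet M K' h = dirichlet M K' g" for K' unfolding dirichlet_def g_def by simp
  moreover have "\<kappa> * L2_inner M g g \<le> L2_inner M g g - L2_inner M g (kernel_op K g)"
  \<comment> \<open>The infimum in \<open>Gap\<close> omits functions that vanish almost everywhere,
    so they are treated apart. On a fibre with trivial \<open>L20\<close> this is the only
    case.\<close>
  proof (cases "AE x in M. g x = 0")
    case zero: True
    note [measurable] = g'(1)
    have "L2_inner M g f = 0" for f
    proof -
      have "AE x in M. g x * f x = 0" using zero by eventually_elim simp
      then show ?thesis unfolding L2_inner_def by (rule integral_eq_zero_AE)
    qed
    then show ?thesis by simp
  next
    case False
    have "L2_inner M g g \<noteq> 0"
    proof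
      assume "L2_inner M g g = 0"
      then have "(\<integral>x. (g x)\<^sup>2 \<partial>M) = 0" by (simp add: L2_inner_def power2_eq_square)
      then have "AE x in M. (g x)\<^sup>2 = 0" by (subst (asm) integral_nonneg_eq_0_iff_AE[OF g'(2)]) auto
      then show False using False by simp
    qed
    moreover have "0 \<le> L2_inner M g g" by (simp add: L2_inner_def)
    ultimately have pos: "0 < L2_inner M g g" by simp
    have "Gap M (kernel_op K) \<le> ereal ((L2_inner M g g - L2_inner M g (kernel_op K g)) / L2_inner M g g)"
      unfolding Gap_def L2_norm_square by (rule INF_lower) (use g False in simp)
    then have "ereal \<kappa> \<le> ereal ((L2_inner M g g - L2_inner M g (kernel_op K g)) / L2_inner M g g)"
      using gap by (rule order_trans[rotated])
    then show ?thesis using pos by (simp add: pos_le_divide_eq)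
  qed
  \<comment> \<open>Hence the resampling form of \<open>g\<close> is 2 <g, g>, and the Rayleigh
    bound just proved becomes a comparison of two Dirichlet forms.\<close>
  moreover have "L2_inner M g (kernel_op (\<lambda>_. M) g) = 0"
    using L20_D(3)[OF g] by (simp add: L2_inner_def kernel_op_def)
  ultimately show ?thesis
    using True by (simp add: K.dirichlet_eq[OF g'] C.dirichlet_eq[OF g'] ennreal_leI flip: ennreal_mult')
qed (simp add: ennreal_neg)

section \<open>Disintegrated measures and kernels acting within fibres\<close>

text \<open>Converts measurability of the real-valued probabilities, which is how the assumption on
  \<open>Qz\<close> is given, into measurability of the kernel as a map.\<close>

lemma measurable_prob_algebra_of_measure:
  assumes K: "\<And>a. a \<in> space M \<Longrightarrow> K a \<in> space (prob_algebra N)"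
    and meas: "\<And>B. B \<in> sets N \<Longrightarrow> (\<lambda>a. measure (K a) B) \<in> borel_measurable M"
  shows "K \<in> M \<rightarrow>\<^sub>M prob_algebra N"
proof (rule measurable_prob_algebraI)
  show "prob_space (K a)" if "a \<in> space M" for a using K[OF that] by (simp add: space_prob_algebra)
  show "K \<in> M \<rightarrow>\<^sub>M subprob_algebra N"
  proof (rule measurable_subprob_algebra)
    fix a assume "a \<in> space M"
    with K show "subprob_space (K a)" "sets (K a) = sets N"
      by (auto simp: space_prob_algebra intro: prob_space_imp_subprob_space)
  next
    fix B assume B: "B \<in> sets N"
    have "(\<lambda>a. ennreal (measure (K a) B)) \<in> borel_measurable M" using meas[OF B] by measurable
    then show "(\<lambda>a. emeasure (K a) B) \<in> borel_measurable M"
      by (rule measurable_cong[THEN iffD1, rotated])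
         (use K in \<open>auto simp: space_prob_algebra prob_space_def finite_measure.emeasure_eq_measure\<close>)
  qed
qed

locale disintegration = prob_space \<pi>t
  for \<pi>t :: "('y \<times> 'z) measure" and Y :: "'y measure" and Z :: "'z measure"
    and \<omega> :: "'z measure" and \<omega>z :: "'z \<Rightarrow> 'y measure" +
  assumes sets_pit: "sets \<pi>t = sets (Y \<Otimes>\<^sub>M Z)"
    and marginal: "\<omega> = distr \<pi>t Z snd"
    and fibre [measurable]: "\<omega>z \<in> Z \<rightarrow>\<^sub>M prob_algebra Y"
    and emeasure_pit: "\<And>A. A \<in> sets (Y \<Otimes>\<^sub>M Z) \<Longrightarrow>
           emeasure \<pi>t A = (\<integral>\<^sup>+z. (\<integral>\<^sup>+y. indicator A (y, z) \<partial>\<omega>z z) \<partial>\<omega>)"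
begin

lemma fibre_subprob [measurable]: "\<omega>z \<in> Z \<rightarrow>\<^sub>M subprob_algebra Y"
  by (rule measurable_prob_algebraD[OF fibre])

lemma space_pit: "space \<pi>t = space Y \<times> space Z"
  using sets_eq_imp_space_eq[OF sets_pit] by (simp add: space_pair_measure)

lemma sets_omega [simp, measurable_cong]: "sets \<omega> = sets Z"
  by (simp add: marginal)

lemma space_omega [simp]: "space \<omega> = space Z"
  by (simp add: marginal)

lemma prob_space_omega: "prob_space \<omega>"
  unfolding marginal by (rule prob_space_distr) (simp add: measurable_cong_sets[OF sets_pit refl])

lemma
  assumes "z \<in> space Z"
  shows prob_space_fibre: "prob_space (\<omega>z z)" and sets_fibre: "sets (\<omega>z z) = sets Y"
  using measurable_space[OF fibre assms] by (auto simp: space_prob_algebra)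

lemma borel_measurable_section:
  assumes "F \<in> borel_measurable (Y \<Otimes>\<^sub>M Z)" "z \<in> space Z"
  shows "(\<lambda>y. F (y, z)) \<in> borel_measurable Y"
  using measurable_compose[OF measurable_Pair2'[OF assms(2)] assms(1)] by simp

lemma borel_measurable_nn_integral_fibre:
  assumes [measurable]: "F \<in> borel_measurable (Y \<Otimes>\<^sub>M Z)"
  shows "(\<lambda>z. \<integral>\<^sup>+y. F (y, z) \<partial>\<omega>z z) \<in> borel_measurable Z"
  by (rule nn_integral_measurable_subprob_algebra2[where N=Y]) measurable

text \<open>The disintegration is given for sets only. Writing \<open>\<pi>t\<close> as
  \<open>\<omega>\<close> bound to the kernel \<open>D\<close>, which places
  \<open>\<omega>z z\<close> on the slice over \<open>z\<close>, extends it to functions.\<close>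

lemma nn_integral_pit:
  assumes F [measurable]: "F \<in> borel_measurable (Y \<Otimes>\<^sub>M Z)"
  shows "(\<integral>\<^sup>+p. F p \<partial>\<pi>t) = (\<integral>\<^sup>+z. \<integral>\<^sup>+y. F (y, z) \<partial>\<omega>z z \<partial>\<omega>)"
proof -
  define D where "D z = distr (\<omega>z z) (Y \<Otimes>\<^sub>M Z) (\<lambda>y. (y, z))" for z
  have D: "D \<in> \<omega> \<rightarrow>\<^sub>M subprob_algebra (Y \<Otimes>\<^sub>M Z)"
    unfolding D_def by (rule measurable_distr2[where M=Y]) measurable
  have nn: "(\<integral>\<^sup>+p. G p \<partial>D z) = (\<integral>\<^sup>+y. G (y, z) \<partial>\<omega>z z)"
    if [measurable]: "G \<in> borel_measurable (Y \<Otimes>\<^sub>M Z)" and z: "z \<in> space Z" for G z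
    unfolding D_def using z
    by (intro nn_integral_distr) (auto simp: measurable_cong_sets[OF sets_fibre[OF z] refl])
  have ne: "space \<omega> \<noteq> {}" using prob_space.not_empty[OF prob_space_omega] .
  have "\<pi>t = \<omega> \<bind> D"
  proof (rule measure_eqI)
    show "sets \<pi>t = sets (\<omega> \<bind> D)" by (subst sets_bind[OF _ ne]) (auto simp: sets_pit D_def)
    fix A assume "A \<in> sets \<pi>t"
    then have [measurable]: "A \<in> sets (Y \<Otimes>\<^sub>M Z)" by (simp add: sets_pit)
    have "emeasure (\<omega> \<bind> D) A = (\<integral>\<^sup>+z. emeasure (D z) A \<partial>\<omega>)"
      by (rule emeasure_bind[OF ne D]) measurable
    also have "\<dots> = (\<integral>\<^sup>+z. \<integral>\<^sup>+p. indicator A p \<partial>D z \<partial>\<omega>)"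
      by (intro nn_integral_cong nn_integral_indicator[symmetric]) (simp add: D_def)
    also have "\<dots> = emeasure \<pi>t A"
      unfolding emeasure_pit[OF \<open>A \<in> sets (Y \<Otimes>\<^sub>M Z)\<close>]
      by (rule nn_integral_cong) (simp add: nn)
    finally show "emeasure \<pi>t A = emeasure (\<omega> \<bind> D) A" by simp
  qed
  then have "(\<integral>\<^sup>+p. F p \<partial>\<pi>t) = (\<integral>\<^sup>+z. \<integral>\<^sup>+p. F p \<partial>D z \<partial>\<omega>)"
    using nn_integral_bind[OF F D] by simp
  also have "\<dots> = (\<integral>\<^sup>+z. \<integral>\<^sup>+y. F (y, z) \<partial>\<omega>z z \<partial>\<omega>)"
    by (rule nn_integral_cong) (simp add: nn)
  finally show ?thesis .
qed

lemma measurable_section_map: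
  assumes "N \<in> space (prob_algebra Y)" "z \<in> space Z"
  shows "(\<lambda>y. (y, z)) \<in> N \<rightarrow>\<^sub>M Y \<Otimes>\<^sub>M Z"
proof -
  have "sets N = sets Y" using assms(1) by (simp add: space_prob_algebra)
  from measurable_cong_sets[OF this refl] show ?thesis using measurable_Pair2'[OF assms(2)] by blast
qed

text \<open>A product with a point mass is an image measure, so integrals against
  \<open>hat_kernel\<close> become integrals over one fibre. \<open>K\<close> is left arbitrary to
  cover both \<open>Qz\<close> and resampling from \<open>\<omega>z\<close>.\<close>

lemma hat_kernel_eq_distr:
  assumes K: "K z y \<in> space (prob_algebra Y)" and z: "z \<in> space Z"
  shows "hat_kernel Z K (y, z) = distr (K z y) (Y \<Otimes>\<^sub>M Z) (\<lambda>y'. (y', z))"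
proof -
  have K': "prob_space (K z y)" "sets (K z y) = sets Y" using K by (auto simp: space_prob_algebra)
  interpret K: prob_space "K z y" by fact
  interpret R: prob_space "return Z z" by (rule prob_space_return) fact
  have sets: "sets (K z y \<Otimes>\<^sub>M return Z z) = sets (Y \<Otimes>\<^sub>M Z)"
    by (rule sets_pair_measure_cong) (simp_all add: K')
  note meas = measurable_section_map[OF K z]
  show ?thesis unfolding hat_kernel_def prod.case
  proof (rule measure_eqI)
    fix A assume A: "A \<in> sets (K z y \<Otimes>\<^sub>M return Z z)"
    then have A': "A \<in> sets (Y \<Otimes>\<^sub>M Z)" unfolding sets .
    have "emeasure (K z y \<Otimes>\<^sub>M return Z z) A = (\<integral>\<^sup>+y'. emeasure (return Z z) (Pair y' -` A) \<partial>K z y)"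
      by (rule R.emeasure_pair_measure_alt[OF A])
    also have "\<dots> = (\<integral>\<^sup>+y'. indicator A (y', z) \<partial>K z y)"
      by (intro nn_integral_cong) (simp add: sets_Pair1[OF A'] indicator_def)
    also have "\<dots> = (\<integral>\<^sup>+p. indicator A p \<partial>distr (K z y) (Y \<Otimes>\<^sub>M Z) (\<lambda>y'. (y', z)))"
      using A' by (intro nn_integral_distr[OF meas, symmetric]) simp
    also have "\<dots> = emeasure (distr (K z y) (Y \<Otimes>\<^sub>M Z) (\<lambda>y'. (y', z))) A"
      using A' by simp
    finally show "emeasure (K z y \<Otimes>\<^sub>M return Z z) A = emeasure (distr (K z y) (Y \<Otimes>\<^sub>M Z) (\<lambda>y'. (y', z))) A" .
  qed (rule trans[OF sets], simp)
qed

lemma nn_integral_hat_kernel: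
  assumes K: "K z y \<in> space (prob_algebra Y)" and z: "z \<in> space Z"
    and F: "F \<in> borel_measurable (Y \<Otimes>\<^sub>M Z)"
  shows "(\<integral>\<^sup>+p. F p \<partial>hat_kernel Z K (y, z)) = (\<integral>\<^sup>+y'. F (y', z) \<partial>K z y)"
  unfolding hat_kernel_eq_distr[where K=K and z=z and y=y, OF K z]
  by (rule nn_integral_distr[OF measurable_section_map[OF K z]]) (simp add: F)

lemma kernel_op_hat_kernel:
  fixes h :: "'y \<times> 'z \<Rightarrow> real"
  assumes K: "K z y \<in> space (prob_algebra Y)" and z: "z \<in> space Z"
    and h: "h \<in> borel_measurable (Y \<Otimes>\<^sub>M Z)"
  shows "kernel_op (hat_kernel Z K) h (y, z) = (\<integral>y'. h (y', z) \<partial>K z y)"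
  unfolding hat_kernel_eq_distr[where K=K and z=z and y=y, OF K z] kernel_op_def
  by (intro integral_distr h measurable_section_map K z)

lemma borel_measurable_dirichlet_integrand:
  assumes [measurable]: "h \<in> borel_measurable (Y \<Otimes>\<^sub>M Z)"
    and K [measurable]: "(\<lambda>(y, z). K z y) \<in> Y \<Otimes>\<^sub>M Z \<rightarrow>\<^sub>M prob_algebra Y"
  shows "(\<lambda>(y, z). \<integral>\<^sup>+y'. ennreal ((h (y, z) - h (y', z))\<^sup>2) \<partial>K z y) \<in> borel_measurable (Y \<Otimes>\<^sub>M Z)"
proof -
  have "(\<lambda>p. \<integral>\<^sup>+y'. ennreal ((h p - h (y', snd p))\<^sup>2) \<partial>(case p of (y, z) \<Rightarrow> K z y)) \<in> borel_measurable (Y \<Otimes>\<^sub>M Z)"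
    by (rule nn_integral_measurable_subprob_algebra2[OF _ measurable_prob_algebraD[OF K]]) measurable
  then show ?thesis by (simp add: case_prod_beta')
qed

lemma dirichlet_hat_kernel:
  assumes h: "h \<in> borel_measurable (Y \<Otimes>\<^sub>M Z)"
    and K: "(\<lambda>(y, z). K z y) \<in> Y \<Otimes>\<^sub>M Z \<rightarrow>\<^sub>M prob_algebra Y"
  shows "dirichlet \<pi>t (hat_kernel Z K) h = (\<integral>\<^sup>+z. dirichlet (\<omega>z z) (K z) (\<lambda>y. h (y, z)) \<partial>\<omega>)"
proof -
  note [measurable] = h
  have K': "K z y \<in> space (prob_algebra Y)" if "y \<in> space Y" "z \<in> space Z" for y z
    using measurable_space[OF K, of "(y, z)"] that by (simp add: space_pair_measure)
  have "dirichlet \<pi>t (hat_kernel Z K) h = (\<integral>\<^sup>+p. (case p of (y, z) \<Rightarrow> \<integral>\<^sup>+y'. ennreal ((h (y, z) - h (y', z))\<^sup>2) \<partial>K z y) \<partial>\<pi>t)"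
    unfolding dirichlet_def
  proof (rule nn_integral_cong)
    fix p assume "p \<in> space \<pi>t"
    then obtain y z where p: "p = (y, z)" "y \<in> space Y" "z \<in> space Z" by (auto simp: space_pit)
    have "(\<integral>\<^sup>+q. ennreal ((h (y, z) - h q)\<^sup>2) \<partial>hat_kernel Z K (y, z)) = (\<integral>\<^sup>+y'. ennreal ((h (y, z) - h (y', z))\<^sup>2) \<partial>K z y)"
      by (rule nn_integral_hat_kernel[where K=K and z=z and y=y, OF K'[OF p(2,3)] p(3)]) measurable
    then show "(\<integral>\<^sup>+q. ennreal ((h p - h q)\<^sup>2) \<partial>hat_kernel Z K p) =
        (case p of (y, z) \<Rightarrow> \<integral>\<^sup>+y'. ennreal ((h (y, z) - h (y', z))\<^sup>2) \<partial>K z y)"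
      by (simp add: p(1))
  qed
  also have "\<dots> = (\<integral>\<^sup>+z. dirichlet (\<omega>z z) (K z) (\<lambda>y. h (y, z)) \<partial>\<omega>)"
    unfolding dirichlet_def by (subst nn_integral_pit[OF borel_measurable_dirichlet_integrand[OF h K]]) simp
  finally show ?thesis .
qed

lemma borel_measurable_dirichlet_fibre:
  assumes h: "h \<in> borel_measurable (Y \<Otimes>\<^sub>M Z)"
    and K: "(\<lambda>(y, z). K z y) \<in> Y \<Otimes>\<^sub>M Z \<rightarrow>\<^sub>M prob_algebra Y"
  shows "(\<lambda>z. dirichlet (\<omega>z z) (K z) (\<lambda>y. h (y, z))) \<in> borel_measurable Z"
  unfolding dirichlet_def
  using borel_measurable_nn_integral_fibre[OF borel_measurable_dirichlet_integrand[OF h K]] by simp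

text \<open>A step never leaves its fibre, so it suffices to apply the invariance of almost every
  \<open>\<omega>z z\<close> to the slices of a set.\<close>

lemma invariant_hat_kernel:
  assumes K: "(\<lambda>(y, z). K z y) \<in> Y \<Otimes>\<^sub>M Z \<rightarrow>\<^sub>M prob_algebra Y"
    and inv: "AE z in \<omega>. invariant_kernel (\<omega>z z) (K z)"
  shows "invariant_kernel \<pi>t (hat_kernel Z K)"
proof -
  have K': "K z y \<in> space (prob_algebra Y)" if "y \<in> space Y" "z \<in> space Z" for y z
    using measurable_space[OF K, of "(y, z)"] that by (simp add: space_pair_measure)
  have "(\<lambda>p. (case p of (y, z) \<Rightarrow> K z y) \<Otimes>\<^sub>M return Z (snd p)) \<in> Y \<Otimes>\<^sub>M Z \<rightarrow>\<^sub>M prob_algebra (Y \<Otimes>\<^sub>M Z)"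
    by (intro measurable_pair_prob K measurable_compose[OF measurable_snd measurable_return_prob_space])
  then have hat: "hat_kernel Z K \<in> Y \<Otimes>\<^sub>M Z \<rightarrow>\<^sub>M prob_algebra (Y \<Otimes>\<^sub>M Z)"
    by (simp add: hat_kernel_def case_prod_beta')
  \<comment> \<open>\<open>\<pi>t\<close> and the product of \<open>Y\<close> and \<open>Z\<close>
    differ as measures; \<open>prob_algebra\<close> depends only on their common measurable
    sets.\<close>
  have "hat_kernel Z K \<in> \<pi>t \<rightarrow>\<^sub>M prob_algebra \<pi>t"
    using hat unfolding prob_algebra_def subprob_algebra_cong[OF sets_pit]
    by (simp add: measurable_cong_sets[OF sets_pit refl])
  note hat' = this measurable_prob_algebraD[OF this]
  show ?thesis
  proof
    show "markov_kernel \<pi>t (hat_kernel Z K)" using hat' by (simp add: markov_kernel_def)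
    show "\<pi>t \<bind> hat_kernel Z K = \<pi>t"
    proof (rule measure_eqI)
      show sets: "sets (\<pi>t \<bind> hat_kernel Z K) = sets \<pi>t"
        by (rule sets_bind[OF sets_kernel[OF hat'(2)] not_empty])
      fix A assume "A \<in> sets (\<pi>t \<bind> hat_kernel Z K)"
      then have A: "A \<in> sets \<pi>t" by (simp add: sets)
      then have A'[measurable]: "A \<in> sets (Y \<Otimes>\<^sub>M Z)" by (simp add: sets_pit)
      have "emeasure (\<pi>t \<bind> hat_kernel Z K) A = (\<integral>\<^sup>+p. emeasure (hat_kernel Z K p) A \<partial>\<pi>t)"
        by (rule emeasure_bind[OF not_empty hat'(2) A])
      also have "\<dots> = (\<integral>\<^sup>+p. (case p of (y, z) \<Rightarrow> \<integral>\<^sup>+y'. indicator A (y', z) \<partial>K z y) \<partial>\<pi>t)"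
      proof (rule nn_integral_cong)
        fix p assume p: "p \<in> space \<pi>t"
        then obtain y z where yz: "p = (y, z)" "y \<in> space Y" "z \<in> space Z" by (auto simp: space_pit)
        have "emeasure (hat_kernel Z K p) A = (\<integral>\<^sup>+q. indicator A q \<partial>hat_kernel Z K p)"
          using A sets_kernel[OF hat'(2) p] by simp
        also have "\<dots> = (\<integral>\<^sup>+y'. indicator A (y', z) \<partial>K z y)"
          unfolding yz(1) by (rule nn_integral_hat_kernel[where K=K and z=z and y=y, OF K'[OF yz(2,3)] yz(3)]) measurable
        finally show "emeasure (hat_kernel Z K p) A = (case p of (y, z) \<Rightarrow> \<integral>\<^sup>+y'. indicator A (y', z) \<partial>K z y)"
          by (simp add: yz(1))
      qed
      also have "\<dots> = (\<integral>\<^sup>+z. \<integral>\<^sup>+y. \<integral>\<^sup>+y'. indicator A (y', z) \<partial>K z y \<partial>\<omega>z z \<partial>\<omega>)"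
      proof (subst nn_integral_pit)
        have "(\<lambda>p. \<integral>\<^sup>+y'. indicator A (y', snd p) \<partial>(case p of (y, z) \<Rightarrow> K z y)) \<in> borel_measurable (Y \<Otimes>\<^sub>M Z)"
          by (rule nn_integral_measurable_subprob_algebra2[OF _ measurable_prob_algebraD[OF K]]) measurable
        then show "(\<lambda>(y, z). \<integral>\<^sup>+y'. indicator A (y', z) \<partial>K z y) \<in> borel_measurable (Y \<Otimes>\<^sub>M Z)"
          by (simp add: case_prod_beta')
      qed simp
      also have "\<dots> = (\<integral>\<^sup>+z. \<integral>\<^sup>+y. indicator A (y, z) \<partial>\<omega>z z \<partial>\<omega>)"
      proof (rule nn_integral_cong_AE)
        show "AE z in \<omega>. (\<integral>\<^sup>+y. \<integral>\<^sup>+y'. indicator A (y', z) \<partial>K z y \<partial>\<omega>z z) = (\<integral>\<^sup>+y. indicator A (y, z) \<partial>\<omega>z z)"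
          using inv AE_space[of \<omega>]
        proof eventually_elim
          case (elim z)
          then have z: "z \<in> space Z" by simp
          have "(\<lambda>y. indicator A (y, z) :: ennreal) \<in> borel_measurable (\<omega>z z)"
            unfolding measurable_cong_sets[OF sets_fibre[OF z] refl]
            by (rule borel_measurable_section[OF _ z]) measurable
          then show ?case by (rule invariant_kernel.nn_integral_kernel[OF elim(1)])
        qed
      qed
      also have "\<dots> = emeasure \<pi>t A" by (simp add: emeasure_pit)
      finally show "emeasure (\<pi>t \<bind> hat_kernel Z K) A = emeasure \<pi>t A" .
    qed
  qed
qed

lemma fibre_kernel_measurable: "(\<lambda>(y, z). (\<lambda>z y. \<omega>z z) z y) \<in> Y \<Otimes>\<^sub>M Z \<rightarrow>\<^sub>M prob_algebra Y"
  by measurable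

lemma invariant_fibre_kernel: "invariant_kernel \<pi>t (hat_kernel Z (\<lambda>z y. \<omega>z z))"
  by (rule invariant_hat_kernel[OF fibre_kernel_measurable], rule AE_I2)
     (simp add: invariant_kernel_const prob_space_fibre)

text \<open>Averaging over a fibre and spreading the average over it again is one step of the kernel
  that resamples y. This puts E* E within reach of \<open>dirichlet_hat_kernel\<close>.\<close>

lemma E_star_E_op_eq_hat_kernel:
  assumes "h \<in> borel_measurable \<pi>t" and "p \<in> space \<pi>t"
  shows "E_star (E_op \<omega>z h) p = kernel_op (hat_kernel Z (\<lambda>z y. \<omega>z z)) h p"
proof -
  obtain y z where p: "p = (y, z)" "y \<in> space Y" "z \<in> space Z" using assms(2) by (auto simp: space_pit)
  have "\<omega>z z \<in> space (prob_algebra Y)" using measurable_space[OF fibre p(3)] .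
  moreover have "h \<in> borel_measurable (Y \<Otimes>\<^sub>M Z)" using assms(1) by (simp add: measurable_cong_sets[OF sets_pit refl])
  ultimately show ?thesis
    by (simp add: p(1) E_star_def E_op_def kernel_op_hat_kernel[where K="\<lambda>z y. \<omega>z z", OF _ p(3)])
qed

lemma poincare_hat_kernel:
  assumes h: "h \<in> borel_measurable \<pi>t" "integrable \<pi>t (\<lambda>p. (h p)\<^sup>2)"
    and K: "(\<lambda>(y, z). K z y) \<in> Y \<Otimes>\<^sub>M Z \<rightarrow>\<^sub>M prob_algebra Y"
    and inv: "AE z in \<omega>. invariant_kernel (\<omega>z z) (K z)"
    and gap: "AE z in \<omega>. ereal \<kappa> \<le> Gap (\<omega>z z) (kernel_op (K z))"
  shows "ennreal \<kappa> * dirichlet \<pi>t (hat_kernel Z (\<lambda>z y. \<omega>z z)) h \<le> dirichlet \<pi>t (hat_kernel Z K) h"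
proof -
  have h'[measurable]: "h \<in> borel_measurable (Y \<Otimes>\<^sub>M Z)"
    using h(1) by (simp add: measurable_cong_sets[OF sets_pit refl])
  have "(\<integral>\<^sup>+z. \<integral>\<^sup>+y. ennreal ((h (y, z))\<^sup>2) \<partial>\<omega>z z \<partial>\<omega>) = (\<integral>\<^sup>+p. ennreal ((h p)\<^sup>2) \<partial>\<pi>t)"
    by (rule nn_integral_pit[symmetric]) measurable
  also have "\<dots> \<noteq> \<infinity>" using h(2) by (simp add: nn_integral_eq_integral)
  \<comment> \<open>Square integrability passes to almost every fibre, where
    \<open>poincare_of_Gap\<close> requires it.\<close>
  finally have "AE z in \<omega>. (\<integral>\<^sup>+y. ennreal ((h (y, z))\<^sup>2) \<partial>\<omega>z z) \<noteq> \<infinity>"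
    by (intro nn_integral_PInf_AE) (simp_all add: measurable_cong_sets[OF sets_omega refl] borel_measurable_nn_integral_fibre[of "\<lambda>p. ennreal ((h p)\<^sup>2)"])
  then have "AE z in \<omega>. ennreal \<kappa> * dirichlet (\<omega>z z) (\<lambda>_. \<omega>z z) (\<lambda>y. h (y, z))
      \<le> dirichlet (\<omega>z z) (K z) (\<lambda>y. h (y, z))"
    using inv gap AE_space[of \<omega>]
  proof eventually_elim
    case (elim z)
    then have z: "z \<in> space Z" by simp
    have m: "(\<lambda>y. h (y, z)) \<in> borel_measurable (\<omega>z z)"
      unfolding measurable_cong_sets[OF sets_fibre[OF z] refl] by (rule borel_measurable_section[OF h' z])
    have "integrable (\<omega>z z) (\<lambda>y. (h (y, z))\<^sup>2)"
      using m elim(1) by (intro integrableI_nonneg) (auto simp: less_top)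
    then show ?case by (rule poincare_of_Gap[OF prob_space_fibre[OF z] elim(2,3) m])
  qed
  then have "(\<integral>\<^sup>+z. ennreal \<kappa> * dirichlet (\<omega>z z) (\<lambda>_. \<omega>z z) (\<lambda>y. h (y, z)) \<partial>\<omega>)
      \<le> (\<integral>\<^sup>+z. dirichlet (\<omega>z z) (K z) (\<lambda>y. h (y, z)) \<partial>\<omega>)"
    by (rule nn_integral_mono_AE)
  then show ?thesis
    unfolding dirichlet_hat_kernel[OF h' K] dirichlet_hat_kernel[OF h' fibre_kernel_measurable]
    by (subst (asm) nn_integral_cmult)
       (use borel_measurable_dirichlet_fibre[OF h' fibre_kernel_measurable] in simp_all)
qed

end

text \<open>Only the part of \<open>Q (y, z)\<close> on the fibre over \<open>z\<close> is used, and the diagonal may be removed from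
  both sides because the integrand vanishes there.\<close>

lemma (in disintegration) dirichlet_hat_kernel_le:
  assumes h: "h \<in> borel_measurable \<pi>t"
    and Q: "invariant_kernel \<pi>t Q"
    and hat: "invariant_kernel \<pi>t (hat_kernel Z K)"
    and K: "\<And>y z. y \<in> space Y \<Longrightarrow> z \<in> space Z \<Longrightarrow> K z y \<in> space (prob_algebra Y)"
    and singleton_Y: "\<And>y. y \<in> space Y \<Longrightarrow> {y} \<in> sets Y"
    and singleton_Z: "\<And>z. z \<in> space Z \<Longrightarrow> {z} \<in> sets Z"
    and c: "0 \<le> c"
    and dom: "AE (y, z) in \<pi>t. \<forall>B\<in>sets Y.
           measure (Q (y, z)) ((B - {y}) \<times> {z}) \<ge> c * measure (K z y) (B - {y})"
  shows "ennreal c * dirichlet \<pi>t (hat_kernel Z K) h \<le> dirichlet \<pi>t Q h"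
proof -
  interpret Q: invariant_kernel \<pi>t Q by fact
  interpret hat: invariant_kernel \<pi>t "hat_kernel Z K" by fact
  have h': "h \<in> borel_measurable (Y \<Otimes>\<^sub>M Z)"
    using h by (simp add: measurable_cong_sets[OF sets_pit refl])
  have "AE p in \<pi>t. ennreal c * (\<integral>\<^sup>+q. ennreal ((h p - h q)\<^sup>2) \<partial>hat_kernel Z K p)
      \<le> (\<integral>\<^sup>+q. ennreal ((h p - h q)\<^sup>2) \<partial>Q p)"
    using dom AE_space[of \<pi>t]
  proof eventually_elim
    case (elim p)
    obtain y z where p: "p = (y, z)" and y: "y \<in> space Y" and z: "z \<in> space Z"
      using elim(2) by (auto simp: space_pit)
    have dom': "c * measure (K z y) (B - {y}) \<le> measure (Q p) ((B - {y}) \<times> {z})" if "B \<in> sets Y" for B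
      using elim(1) that by (simp add: p)
    interpret Kp: prob_space "K z y" using K[OF y z] by (simp add: space_prob_algebra)
    interpret Qp: prob_space "Q p" by (rule Q.prob_space_kernel[OF elim(2)])
    have sets_K: "sets (K z y) = sets Y" using K[OF y z] by (simp add: space_prob_algebra)
    have sets_Q: "sets (Q p) = sets (Y \<Otimes>\<^sub>M Z)" using Q.sets_kernel_eq[OF elim(2)] sets_pit by simp
    define \<phi> where "\<phi> y' = ennreal ((h p - h (y', z))\<^sup>2)" for y'
    have section_meas: "(\<lambda>y'. h (y', z)) \<in> borel_measurable Y" by (rule borel_measurable_section[OF h' z])
    have \<phi>_meas: "\<phi> \<in> borel_measurable Y" unfolding \<phi>_def using section_meas by measurable
    \<comment> \<open>\<open>N\<close> is the off-diagonal part of \<open>K z y\<close>, and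
      \<open>R\<close> is the part of \<open>Q p\<close> on the fibre over \<open>z\<close>,
      projected to \<open>Y\<close>. The set-by-set hypothesis becomes the inequality c N \<le> R
      between measures on \<open>Y\<close>, which can be integrated against \<phi>.\<close>
    define N where "N = density (K z y) (indicator (space Y - {y}))"
    define R where "R = distr (density (Q p) (indicator (space Y \<times> {z}))) Y fst"
    have fst_meas: "fst \<in> density (Q p) (indicator (space Y \<times> {z})) \<rightarrow>\<^sub>M Y"
      using measurable_cong_sets[of "density (Q p) (indicator (space Y \<times> {z}))" "Y \<Otimes>\<^sub>M Z" Y Y] sets_Q
      by simp
    have fibre_set: "B \<times> {z} \<in> sets (Q p)" if "B \<in> sets Y" for B
      unfolding sets_Q using that singleton_Z[OF z] by (rule pair_measureI)
    have diag: "B - {y} \<in> sets Y" if "B \<in> sets Y" for B using that singleton_Y[OF y] by (rule sets.Diff)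
    have emeasure_N: "emeasure N B = emeasure (K z y) (B - {y})" if B: "B \<in> sets Y" for B
    proof -
      have "emeasure N B = (\<integral>\<^sup>+y'. indicator (space Y - {y}) y' * indicator B y' \<partial>K z y)"
        unfolding N_def using B diag[of "space Y"]
        by (intro emeasure_density borel_measurable_indicator) (simp_all add: sets_K)
      also have "\<dots> = (\<integral>\<^sup>+y'. indicator (B - {y}) y' \<partial>K z y)"
        using sets.sets_into_space[OF B] by (intro nn_integral_cong) (auto simp: indicator_def)
      also have "\<dots> = emeasure (K z y) (B - {y})"
        using diag[OF B] by (intro nn_integral_indicator) (simp add: sets_K)
      finally show ?thesis .
    qed
    have emeasure_R: "emeasure R B = emeasure (Q p) (B \<times> {z})" if B: "B \<in> sets Y" for B
    proof -
      have pre: "fst -` B \<inter> space (density (Q p) (indicator (space Y \<times> {z}))) \<in> sets (Q p)"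
        using measurable_sets[OF fst_meas B] by simp
      have "emeasure R B = emeasure (density (Q p) (indicator (space Y \<times> {z})))
          (fst -` B \<inter> space (density (Q p) (indicator (space Y \<times> {z}))))"
        unfolding R_def by (rule emeasure_distr[OF fst_meas B])
      also have "\<dots> = (\<integral>\<^sup>+q. indicator (space Y \<times> {z}) q *
          indicator (fst -` B \<inter> space (density (Q p) (indicator (space Y \<times> {z})))) q \<partial>Q p)"
        using pre fibre_set[of "space Y"] by (intro emeasure_density) auto
      also have "\<dots> = (\<integral>\<^sup>+q. indicator (B \<times> {z}) q \<partial>Q p)"
        using sets.sets_into_space[OF B] by (intro nn_integral_cong) (auto simp: indicator_def)
      also have "\<dots> = emeasure (Q p) (B \<times> {z})"
        by (rule nn_integral_indicator[OF fibre_set[OF B]])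
      finally show ?thesis .
    qed
    have "scale_measure (ennreal c) N \<le> R"
    proof (subst le_measure)
      show "sets (scale_measure (ennreal c) N) = sets R" by (simp add: N_def R_def sets_K)
      show "\<forall>B\<in>sets (scale_measure (ennreal c) N). emeasure (scale_measure (ennreal c) N) B \<le> emeasure R B"
      proof
        fix B assume "B \<in> sets (scale_measure (ennreal c) N)"
        then have B: "B \<in> sets Y" by (simp add: N_def sets_K)
        have "emeasure (scale_measure (ennreal c) N) B = ennreal (c * measure (K z y) (B - {y}))"
          using c by (simp add: emeasure_N[OF B] Kp.emeasure_eq_measure ennreal_mult)
        also have "\<dots> \<le> emeasure (Q p) ((B - {y}) \<times> {z})"
          unfolding Qp.emeasure_eq_measure by (rule ennreal_leI[OF dom'[OF B]])
        \<comment> \<open>Restoring the mass of \<open>Q p\<close> at the diagonal point only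
          enlarges the right-hand side.\<close>
        also have "\<dots> \<le> emeasure (Q p) (B \<times> {z})"
          by (rule emeasure_mono[OF _ fibre_set[OF B]]) auto
        finally show "emeasure (scale_measure (ennreal c) N) B \<le> emeasure R B"
          by (simp add: emeasure_R[OF B])
      qed
    qed
    then have mono: "(\<integral>\<^sup>+y'. \<phi> y' \<partial>scale_measure (ennreal c) N) \<le> (\<integral>\<^sup>+y'. \<phi> y' \<partial>R)"
      by (intro nn_integral_mono_measure) (simp_all add: N_def R_def sets_K)
    have "(\<integral>\<^sup>+q. ennreal ((h p - h q)\<^sup>2) \<partial>hat_kernel Z K p) = (\<integral>\<^sup>+y'. \<phi> y' \<partial>K z y)"
      unfolding p \<phi>_def using h'
      by (intro nn_integral_hat_kernel[where K=K and z=z and y=y, OF K[OF y z] z]) measurable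
    also have "\<dots> = (\<integral>\<^sup>+y'. indicator (space Y - {y}) y' * \<phi> y' \<partial>K z y)"
      using sets_eq_imp_space_eq[OF sets_K]
      by (intro nn_integral_cong) (auto simp: indicator_def \<phi>_def p)
    also have "\<dots> = (\<integral>\<^sup>+y'. \<phi> y' \<partial>N)"
      unfolding N_def using \<phi>_meas diag[of "space Y"]
      by (intro nn_integral_density[symmetric]) (auto simp: measurable_cong_sets[OF sets_K refl] sets_K)
    finally have "ennreal c * (\<integral>\<^sup>+q. ennreal ((h p - h q)\<^sup>2) \<partial>hat_kernel Z K p)
        = (\<integral>\<^sup>+y'. \<phi> y' \<partial>scale_measure (ennreal c) N)"
      using \<phi>_meas by (simp add: nn_integral_scale_measure N_def measurable_cong_sets[OF sets_K refl])
    also note mono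
    also have "(\<integral>\<^sup>+y'. \<phi> y' \<partial>R) = (\<integral>\<^sup>+q. \<phi> (fst q) \<partial>density (Q p) (indicator (space Y \<times> {z})))"
      unfolding R_def by (rule nn_integral_distr[OF fst_meas]) (simp add: \<phi>_meas)
    also have "\<dots> = (\<integral>\<^sup>+q. indicator (space Y \<times> {z}) q * \<phi> (fst q) \<partial>Q p)"
      using fibre_set[of "space Y"] measurable_compose[OF measurable_fst \<phi>_meas]
      by (intro nn_integral_density borel_measurable_indicator) (simp_all add: measurable_cong_sets[OF sets_Q refl])
    \<comment> \<open>Moves of \<open>Q\<close> to other fibres contribute a nonnegative amount,
      which is dropped.\<close>
    also have "\<dots> \<le> (\<integral>\<^sup>+q. ennreal ((h p - h q)\<^sup>2) \<partial>Q p)"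
      by (intro nn_integral_mono) (auto simp: indicator_def \<phi>_def)
    finally show ?case .
  qed
  then have "(\<integral>\<^sup>+p. ennreal c * (\<integral>\<^sup>+q. ennreal ((h p - h q)\<^sup>2) \<partial>hat_kernel Z K p) \<partial>\<pi>t)
      \<le> dirichlet \<pi>t Q h"
    unfolding dirichlet_def by (rule nn_integral_mono_AE)
  then show ?thesis
    unfolding dirichlet_def[of _ "hat_kernel Z K"]
    by (subst (asm) nn_integral_cmult) (rule hat.borel_measurable_dirichlet_density[OF h])
qed

section \<open>The two gap inequalities\<close>

lemma L20_cong:
  assumes "\<And>x. x \<in> space M \<Longrightarrow> f x = g x" and "g \<in> L20 M"
  shows "f \<in> L20 M"
  using assms measurable_cong[of M f g borel] Bochner_Integration.integrable_cong[of M M "\<lambda>x. (f x)\<^sup>2" "\<lambda>x. (g x)\<^sup>2"]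
    Bochner_Integration.integral_cong[of M M f g]
  by (simp add: L20_def)

theorem corollary14:
  fixes \<pi> :: "'x measure"
    and Y :: "'y measure" and Z :: "'z measure"
    and \<pi>t :: "('y \<times> 'z) measure"
    and \<omega> :: "'z measure" and \<omega>z :: "'z \<Rightarrow> 'y measure"
    and S :: "'x \<Rightarrow> 'x measure"
    and P :: "('x \<Rightarrow> real) \<Rightarrow> ('y \<times> 'z \<Rightarrow> real)"
    and Q :: "'y \<times> 'z \<Rightarrow> ('y \<times> 'z) measure"
    and Qz :: "'z \<Rightarrow> 'y \<Rightarrow> 'y measure"
    and c0 \<kappa> :: real
  assumes "prob_space \<pi>"
    and "prob_space \<pi>t" and "sets \<pi>t = sets (Y \<Otimes>\<^sub>M Z)"
    and "\<And>y. y \<in> space Y \<Longrightarrow> {y} \<in> sets Y"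
    and "\<And>z. z \<in> space Z \<Longrightarrow> {z} \<in> sets Z"
    and "\<omega> = distr \<pi>t Z snd"
    and "\<omega>z \<in> Z \<rightarrow>\<^sub>M prob_algebra Y"
    and "\<And>A. A \<in> sets (Y \<Otimes>\<^sub>M Z) \<Longrightarrow>
           emeasure \<pi>t A = (\<integral>\<^sup>+z. (\<integral>\<^sup>+y. indicator A (y, z) \<partial>\<omega>z z) \<partial>\<omega>)"
    and "reversible \<pi> S"
    and "L20_linear \<pi> \<pi>t P"
    and "reversible \<pi>t Q"
    and "\<And>f. f \<in> L20 \<pi> \<Longrightarrow>
           AE x in \<pi>. kernel_op S f x = (L2_adjoint \<pi> \<pi>t P \<circ> kernel_op Q \<circ> P) f x"
    and "\<And>f. f \<in> L20 \<pi> \<Longrightarrow> L2_norm \<pi>t (P f) \<le> L2_norm \<pi> f"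
    and "\<And>z. z \<in> space Z \<Longrightarrow> markov_kernel Y (Qz z)"
    and "AE z in \<omega>. reversible (\<omega>z z) (Qz z)"
    and "\<And>B. B \<in> sets Y \<Longrightarrow>
           (\<lambda>(y, z). measure (Qz z y) B) \<in> borel_measurable (Y \<Otimes>\<^sub>M Z)"
    and "0 < c0" and "c0 \<le> 1"
    and "AE (y, z) in \<pi>t. \<forall>B\<in>sets Y.
           measure (Q (y, z)) ((B - {y}) \<times> {z}) \<ge> c0 * measure (Qz z y) (B - {y})"
    and "0 \<le> \<kappa>" and "\<kappa> \<le> 1"
    and "AE z in \<omega>. Gap (\<omega>z z) (kernel_op (Qz z)) \<ge> ereal \<kappa>"
  shows "Gap \<pi> (kernel_op S) \<ge>
           ereal c0 * Gap \<pi> (L2_adjoint \<pi> \<pi>t P \<circ> kernel_op (hat_kernel Z Qz) \<circ> P) \<and>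
         ereal c0 * Gap \<pi> (L2_adjoint \<pi> \<pi>t P \<circ> kernel_op (hat_kernel Z Qz) \<circ> P) \<ge>
           ereal c0 * ereal \<kappa> * Gap \<pi> (L2_adjoint \<pi> \<pi>t P \<circ> E_star \<circ> E_op \<omega>z \<circ> P)"
proof -
  interpret X: prob_space \<pi> by (rule assms(1))
  interpret disintegration \<pi>t Y Z \<omega> \<omega>z
    by (rule disintegration.intro[OF assms(2)], unfold_locales) (fact assms)+
  let ?H = "hat_kernel Z Qz" and ?F = "hat_kernel Z (\<lambda>z y. \<omega>z z)" and ?A = "L2_adjoint \<pi> \<pi>t P"
  have Qz_prob: "Qz z y \<in> space (prob_algebra Y)" if "y \<in> space Y" "z \<in> space Z" for y z
    using measurable_space[OF assms(14)[OF that(2), unfolded markov_kernel_def] that(1)] .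
  have Qz: "(\<lambda>(y, z). Qz z y) \<in> Y \<Otimes>\<^sub>M Z \<rightarrow>\<^sub>M prob_algebra Y"
  proof (rule measurable_prob_algebra_of_measure)
    show "(\<lambda>p. measure (case p of (y, z) \<Rightarrow> Qz z y) B) \<in> borel_measurable (Y \<Otimes>\<^sub>M Z)" if "B \<in> sets Y" for B
      using assms(16)[OF that] by (simp add: case_prod_beta')
  qed (auto simp: space_pair_measure Qz_prob)
  have Qz_inv: "AE z in \<omega>. invariant_kernel (\<omega>z z) (Qz z)"
    using assms(15) AE_space[of \<omega>]
    by eventually_elim (simp add: reversible_invariant_kernel prob_space_fibre)
  interpret S: invariant_kernel \<pi> S by (rule reversible_invariant_kernel[OF assms(1,9)])
  interpret Q: invariant_kernel \<pi>t Q by (rule reversible_invariant_kernel[OF assms(2,11)])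
  interpret H: invariant_kernel \<pi>t ?H by (rule invariant_hat_kernel[OF Qz Qz_inv])
  interpret F: invariant_kernel \<pi>t ?F by (rule invariant_fibre_kernel)
  have adj: "is_L2_adjoint \<pi> \<pi>t P ?A"
    by (rule is_L2_adjoint_L2_adjoint[OF assms(1,10,13)])
  have P: "P f \<in> L20 \<pi>t" if "f \<in> L20 \<pi>" for f
    using assms(10) that by (simp add: L20_linear_def)
  have P_le: "L2_inner \<pi>t (P f) (P f) \<le> L2_inner \<pi> f f" if f: "f \<in> L20 \<pi>" for f
    using power_mono[OF assms(13)[OF f], of 2] by (simp add: L2_norm_square) (simp add: L2_norm_def L2_inner_def)
  have A: "?A g \<in> L20 \<pi>" if "g \<in> L20 \<pi>t" for g
    using adj that by (simp add: is_L2_adjoint_def)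
  have inner_A: "L2_inner \<pi> f (?A g) = L2_inner \<pi>t (P f) g" if "f \<in> L20 \<pi>" "g \<in> L20 \<pi>t" for f g
    using adj that by (simp add: is_L2_adjoint_def)
  \<comment> \<open>The factorisation of \<open>S\<close> holds almost everywhere, which is enough
    for quadratic forms.\<close>
  have inner_S: "L2_inner \<pi> f (kernel_op S f) = L2_inner \<pi>t (P f) (kernel_op Q (P f))" if f: "f \<in> L20 \<pi>" for f
  proof -
    have "L2_inner \<pi> f (kernel_op S f) = L2_inner \<pi> f (?A (kernel_op Q (P f)))"
      using assms(12)[OF f] L20_D(1)[OF f] L20_D(1)[OF A[OF Q.kernel_op_L20[OF P[OF f]]]]
      by (intro L2_inner_cong_AE) (simp_all add: S.borel_measurable_kernel_op)
    then show ?thesis by (simp add: inner_A f P Q.kernel_op_L20)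
  qed
  \<comment> \<open>Add (1 - c)(a - b) \<ge> 0 on the right. It is used with b and a the squared
    norms of \<open>P f\<close> and \<open>f\<close>.\<close>
  have contraction: "c * (b - d) \<le> b - e \<Longrightarrow> c * (a - d) \<le> a - e"
    if "0 \<le> c" "c \<le> 1" "b \<le> a" for a b c d e :: real
    using mult_right_mono[OF that(2), of "a - b"] that(3) by (simp add: algebra_simps)
  have first: "ereal c0 * Gap \<pi> (?A \<circ> kernel_op ?H \<circ> P) \<le> Gap \<pi> (kernel_op S)"
  proof (rule Gap_mono_scaled)
    fix f assume f: "f \<in> L20 \<pi>"
    note u = L20_D(1,2)[OF P[OF f]]
    have "ennreal c0 * dirichlet \<pi>t ?H (P f) \<le> dirichlet \<pi>t Q (P f)"
      using assms(17,19)
      by (intro dirichlet_hat_kernel_le[OF u(1) Q.invariant_kernel_axioms H.invariant_kernel_axioms Qz_prob assms(4,5)]) auto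
    then have "c0 * (L2_inner \<pi>t (P f) (P f) - L2_inner \<pi>t (P f) (kernel_op ?H (P f)))
        \<le> L2_inner \<pi>t (P f) (P f) - L2_inner \<pi>t (P f) (kernel_op Q (P f))"
      using assms(17)
      by (intro inner_gap_le_of_dirichlet_le[OF H.invariant_kernel_axioms Q.invariant_kernel_axioms _ u]) auto
    then have "c0 * (L2_inner \<pi> f f - L2_inner \<pi>t (P f) (kernel_op ?H (P f)))
        \<le> L2_inner \<pi> f f - L2_inner \<pi>t (P f) (kernel_op Q (P f))"
      by (rule contraction[rotated 3]) (use assms(17,18) P_le[OF f] in auto)
    then show "c0 * (L2_inner \<pi> f f - L2_inner \<pi> f ((?A \<circ> kernel_op ?H \<circ> P) f))
        \<le> L2_inner \<pi> f f - L2_inner \<pi> f (kernel_op S f)"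
      by (simp add: inner_S f inner_A P H.kernel_op_L20)
  qed (use assms(17) in simp)
  have second: "ereal \<kappa> * Gap \<pi> (?A \<circ> E_star \<circ> E_op \<omega>z \<circ> P) \<le> Gap \<pi> (?A \<circ> kernel_op ?H \<circ> P)"
  proof (rule Gap_mono_scaled)
    fix f assume f: "f \<in> L20 \<pi>"
    note u = L20_D(1,2)[OF P[OF f]]
    have E: "E_star (E_op \<omega>z (P f)) p = kernel_op ?F (P f) p" if "p \<in> space \<pi>t" for p
      by (rule E_star_E_op_eq_hat_kernel[OF u(1) that])
    \<comment> \<open>The adjoint identity for P* applies only to members of
      \<open>L20 \<pi>t\<close>; membership is inherited from the resampling kernel.\<close>
    have E_L20: "E_star (E_op \<omega>z (P f)) \<in> L20 \<pi>t"
      by (rule L20_cong[OF E F.kernel_op_L20[OF P[OF f]]])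
    have E_inner: "L2_inner \<pi>t (P f) (E_star (E_op \<omega>z (P f))) = L2_inner \<pi>t (P f) (kernel_op ?F (P f))"
      unfolding L2_inner_def by (rule Bochner_Integration.integral_cong[OF refl]) (simp add: E)
    have "ennreal \<kappa> * dirichlet \<pi>t ?F (P f) \<le> dirichlet \<pi>t ?H (P f)"
      by (rule poincare_hat_kernel[OF u Qz Qz_inv assms(22)])
    then have "\<kappa> * (L2_inner \<pi>t (P f) (P f) - L2_inner \<pi>t (P f) (kernel_op ?F (P f)))
        \<le> L2_inner \<pi>t (P f) (P f) - L2_inner \<pi>t (P f) (kernel_op ?H (P f))"
      using assms(20)
      by (intro inner_gap_le_of_dirichlet_le[OF F.invariant_kernel_axioms H.invariant_kernel_axioms _ u]) auto
    then have "\<kappa> * (L2_inner \<pi> f f - L2_inner \<pi>t (P f) (kernel_op ?F (P f)))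
        \<le> L2_inner \<pi> f f - L2_inner \<pi>t (P f) (kernel_op ?H (P f))"
      by (rule contraction[rotated 3]) (use assms(20,21) P_le[OF f] in auto)
    then show "\<kappa> * (L2_inner \<pi> f f - L2_inner \<pi> f ((?A \<circ> E_star \<circ> E_op \<omega>z \<circ> P) f))
        \<le> L2_inner \<pi> f f - L2_inner \<pi> f ((?A \<circ> kernel_op ?H \<circ> P) f)"
      by (simp add: f inner_A P H.kernel_op_L20 E_L20 E_inner)
  qed (use assms(20) in simp)
  have "ereal c0 * (ereal \<kappa> * Gap \<pi> (?A \<circ> E_star \<circ> E_op \<omega>z \<circ> P)) \<le> ereal c0 * Gap \<pi> (?A \<circ> kernel_op ?H \<circ> P)"
    by (rule ereal_mult_left_mono[OF second]) (use assms(17) in simp)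
  then show ?thesis using first by (simp only: mult.assoc)
qed

end
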